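(* Let $G$ be a connected ribbon graph. Then $L(G;x,y,z)=L(D(G);x,y,z)$.
   Context: A ribbon graph $G=(V,E)$ is a surface with boundary, represented as the union of two finite sets of discs, the vertices $V$ and the edges $E$, such that: the vertices and edges intersect in disjoint line segments; each such line segment lies on the boundary of precisely one vertex and precisely one edge; every edge contains exactly two such line segments. For $A\subseteq E$, $f(A)$ is the number of boundary components of the spanning ribbon subgraph $(V,A)$; $k(G)$ is the number of connected components of $G$. The delta-matroid $D(G)$ has ground set $E$ and feasible sets the $A\subseteq E$ with $f(A)=k(G)$ (the edge sets of spanning quasi-trees). The geometric dual $G^*$ is obtained by capping off each boundary component of $G$ with a disc, taking these discs as the vertices of $G^*$, deleting the vertices of $G$, and keeping the same edges, so $E(G^* )=E(G)$. $M(G)$ is the cycle matroid of the underlying graph of $G$ (bases are the edge sets of maximal spanning forests), and $B(G^* ):=(M(G^* ))^*$. For a matroid $M$, $r_M$ is its rank function and $n_M(A)=|A|-r_M(A)$. For a delta-matroid $D=(E,\mathcal{F})$ (a set $E$ with a non-empty collection $\mathcal F$ of subsets such that for all $X,Y\in\mathcal F$ and $u\in X\bigtriangleup Y$ there is $v\in X\bigtriangleup Y$, possibly $v=u$, with $X\bigtriangleup\{u,v\}\in\mathcal F$), $D_{\min}$ and $D_{\max}$ are the matroids on $E$ whose bases are the feasible sets of $D$ of minimum, respectively maximum, cardinality. The Las Vergnas polynomial of a ribbon graph $G$ is $$L(G;x,y,z)=\sum_{A\subseteq E}(x-1)^{r_{M(G)}(E)-r_{M(G)}(A)}(y-1)^{n_{B(G^*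 )}(A)}z^{r_{B(G^* )}(E)-r_{M(G)}(E)-(r_{B(G^* )}(A)-r_{M(G)}(A))}.$$ The Las Vergnas polynomial of a delta-matroid $D=(E,\mathcal{F})$ is $$L(D;x,y,z)=\sum_{A\subseteq E}(x-1)^{r_{D_{\min}}(E)-r_{D_{\min}}(A)}(y-1)^{n_{D_{\max}}(A)}z^{r_{D_{\max}}(E)-r_{D_{\min}}(E)-(r_{D_{\max}}(A)-r_{D_{\min}}(A))}.$$ *)

theory Defs
  imports "HOL-Analysis.Analysis"
begin

section \<open>Surfaces\<close>

text \<open>The complex numbers serve as the model plane, and the closed upper half plane as the
  model half plane.\<close>

definition surface :: "'p topology \<Rightarrow> bool" where
  "surface X \<longleftrightarrow> Hausdorff_space X \<and> second_countable X \<and>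
     (\<forall>p \<in> topspace X. \<exists>U W. openin X U \<and> p \<in> U \<and>
        openin (top_of_set {w::complex. 0 \<le> Im w}) W \<and>
        subtopology X U homeomorphic_space top_of_set W)"

text \<open>The manifold boundary, i.e. the points without a neighbourhood homeomorphic to an open
  subset of the plane.\<close>

definition surface_boundary :: "'p topology \<Rightarrow> 'p set" where
  "surface_boundary X = {p \<in> topspace X. \<not> (\<exists>U W. openin X U \<and> p \<in> U \<and>
        open (W :: complex set) \<and> subtopology X U homeomorphic_space top_of_set W)}"

definition boundary_components :: "'p topology \<Rightarrow> 'p set set" where
  "boundary_components X = connected_components_of (subtopology X (surface_boundary X))"

definition is_disc :: "'p topology \<Rightarrow> 'p set \<Rightarrow> bool" where
  "is_disc X D \<longleftrightarrow> D \<subseteq> topspace X \<and>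
     subtopology X D homeomorphic_space top_of_set (cball (0::complex) 1)"

definition disc_boundary :: "'p topology \<Rightarrow> 'p set \<Rightarrow> 'p set" where
  "disc_boundary X D = surface_boundary (subtopology X D)"

definition is_segment :: "'p topology \<Rightarrow> 'p set \<Rightarrow> bool" where
  "is_segment X s \<longleftrightarrow> s \<subseteq> topspace X \<and>
     subtopology X s homeomorphic_space top_of_set {0..1::real}"


section \<open>Ribbon graphs\<close>

text \<open>Vertices are the discs themselves.  Edges carry names of type \<open>'e\<close>, so that a ribbon graph
  and its geometric dual, which live on different surfaces, can have the same edge set.\<close>

record ('p, 'e) ribbon =
  surf :: "'p topology"
  verts :: "'p set set"
  edges :: "'e set"
  edge_disc :: "'e \<Rightarrow> 'p set"

text \<open>The set \<open>S\<close> consists of the line segments in which vertices and edges meet.  Distinct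
  vertices are disjoint, and so are distinct edges: the discs meet nowhere else.\<close>

definition ribbon_graph :: "('p, 'e) ribbon \<Rightarrow> bool" where
  "ribbon_graph G \<longleftrightarrow>
     surface (surf G) \<and> finite (verts G) \<and> finite (edges G) \<and>
     (\<forall>v \<in> verts G. is_disc (surf G) v) \<and>
     (\<forall>e \<in> edges G. is_disc (surf G) (edge_disc G e)) \<and>
     disjoint (verts G) \<and> disjoint_family_on (edge_disc G) (edges G) \<and>
     topspace (surf G) = \<Union>(verts G) \<union> \<Union>(edge_disc G ` edges G) \<and>
     (\<exists>S. disjoint S \<and> (\<forall>s \<in> S. is_segment (surf G) s) \<and>
        \<Union>(verts G) \<inter> \<Union>(edge_disc G ` edges G) = \<Union>S \<and>
        (\<forall>s \<in> S. (\<exists>!v. v \<in> verts G \<and> s \<subseteq> disc_boundary (surf G) v) \<and>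
                  (\<exists>!e. e \<in> edges G \<and> s \<subseteq> disc_boundary (surf G) (edge_disc G e))) \<and>
        (\<forall>e \<in> edges G. card {s \<in> S. s \<subseteq> edge_disc G e} = 2))"

definition connected_ribbon :: "('p, 'e) ribbon \<Rightarrow> bool" where
  "connected_ribbon G \<longleftrightarrow> connected_space (surf G)"

definition num_components :: "('p, 'e) ribbon \<Rightarrow> nat" where
  "num_components G = card (connected_components_of (surf G))"

definition spanning_surface :: "('p, 'e) ribbon \<Rightarrow> 'e set \<Rightarrow> 'p topology" where
  "spanning_surface G A = subtopology (surf G) (\<Union>(verts G) \<union> \<Union>(edge_disc G ` A))"

definition num_boundary :: "('p, 'e) ribbon \<Rightarrow> 'e set \<Rightarrow> nat" where
  "num_boundary G A = card (boundary_components (spanning_surface G A))"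

text \<open>\<open>geometric_dual G H\<close> states that \<open>H\<close> is a geometric dual of \<open>G\<close>, unique up to
  homeomorphism: \<open>Y\<close> is the closed surface obtained by capping off \<open>G\<close>, embedded
  in \<open>Y\<close> by \<open>h\<close>, and the vertices of \<open>H\<close> are the caps, one for every boundary component of \<open>G\<close>.
  As the caps are disjoint, they are determined by their boundary circles.  The surface of \<open>H\<close>
  is what remains of \<open>Y\<close> once the vertices of \<open>G\<close> have been deleted.\<close>

definition geometric_dual :: "('p, 'e) ribbon \<Rightarrow> ('q, 'e) ribbon \<Rightarrow> bool" where
  "geometric_dual G H \<longleftrightarrow> ribbon_graph H \<and>
     (\<exists>Y h. surface Y \<and> surface_boundary Y = {} \<and> embedding_map (surf G) Y h \<and>
        topspace Y = h ` topspace (surf G) \<union> \<Union>(verts H) \<and>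
        disjoint (verts H) \<and>
        (\<forall>d \<in> verts H. is_disc Y d \<and> d \<inter> h ` topspace (surf G) = disc_boundary Y d) \<and>
        disc_boundary Y ` verts H = (\<lambda>c. h ` c) ` boundary_components (surf G) \<and>
        edges H = edges G \<and>
        (\<forall>e \<in> edges G. edge_disc H e = h ` edge_disc G e) \<and>
        surf H = subtopology Y (\<Union>(verts H) \<union> \<Union>(edge_disc H ` edges H)))"


section \<open>Set systems: matroids given by bases, delta-matroids given by feasible sets\<close>

type_synonym 'e set_system = "'e set \<times> 'e set set"

definition matroid_rank :: "'e set_system \<Rightarrow> 'e set \<Rightarrow> nat" where
  "matroid_rank M A = Max (card ` {I. I \<subseteq> A \<and> (\<exists>B \<in> snd M. I \<subseteq> B)})"

definition matroid_nullity :: "'e set_system \<Rightarrow> 'e set \<Rightarrow> nat" where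
  "matroid_nullity M A = card A - matroid_rank M A"

definition dual_matroid :: "'e set_system \<Rightarrow> 'e set_system" where
  "dual_matroid M = (fst M, (\<lambda>B. fst M - B) ` snd M)"

definition D_min :: "'e set_system \<Rightarrow> 'e set_system" where
  "D_min D = (fst D, {X \<in> snd D. \<forall>Y \<in> snd D. card X \<le> card Y})"

definition D_max :: "'e set_system \<Rightarrow> 'e set_system" where
  "D_max D = (fst D, {X \<in> snd D. \<forall>Y \<in> snd D. card Y \<le> card X})"


section \<open>The delta-matroid and the cycle matroid of a ribbon graph\<close>

definition delta_matroid_of :: "('p, 'e) ribbon \<Rightarrow> 'e set_system" where
  "delta_matroid_of G =
     (edges G, {A. A \<subseteq> edges G \<and> num_boundary G A = num_components G})"

definition ends :: "('p, 'e) ribbon \<Rightarrow> 'e \<Rightarrow> 'p set set" where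
  "ends G e = {v \<in> verts G. v \<inter> edge_disc G e \<noteq> {}}"

text \<open>A cycle of the underlying multigraph passes through the distinct vertices \<open>vs\<close> and the
  distinct edges \<open>es\<close>; cycles of length one are loops, those of length two consist of a pair of
  parallel edges.\<close>

definition is_cycle :: "('p, 'e) ribbon \<Rightarrow> 'p set list \<Rightarrow> 'e list \<Rightarrow> bool" where
  "is_cycle G vs es \<longleftrightarrow> es \<noteq> [] \<and> length vs = length es \<and> distinct vs \<and> distinct es \<and>
     set vs \<subseteq> verts G \<and> set es \<subseteq> edges G \<and>
     (\<forall>i < length es. ends G (es ! i) = {vs ! i, vs ! (Suc i mod length es)})"

definition is_forest :: "('p, 'e) ribbon \<Rightarrow> 'e set \<Rightarrow> bool" where
  "is_forest G A \<longleftrightarrow> A \<subseteq> edges G \<and> \<not> (\<exists>vs es. is_cycle G vs es \<and> set es \<subseteq> A)"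

definition cycle_matroid :: "('p, 'e) ribbon \<Rightarrow> 'e set_system" where
  "cycle_matroid G =
     (edges G, {A. is_forest G A \<and> (\<forall>A'. is_forest G A' \<and> A \<subseteq> A' \<longrightarrow> A' = A)})"


section \<open>Las Vergnas polynomials\<close>

text \<open>The polynomials are rendered as functions of \<open>x\<close>, \<open>y\<close>, \<open>z\<close> in an arbitrary commutative
  ring.  The exponent of \<open>z\<close> is computed in the integers; like the other exponents it is
  nonnegative, since in both uses below \<open>M\<close> is a quotient of \<open>B\<close>.\<close>

definition las_vergnas ::
  "'e set_system \<Rightarrow> 'e set_system \<Rightarrow> 'e set \<Rightarrow> 'r \<Rightarrow> 'r \<Rightarrow> 'r \<Rightarrow> 'r::comm_ring_1" where
  "las_vergnas M B E x y z =
     (\<Sum>A \<in> Pow E. (x - 1) ^ (matroid_rank M E - matroid_rank M A) * (y - 1) ^ matroid_nullity B A *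
        z ^ nat (int (matroid_rank B E) - int (matroid_rank M E) - (int (matroid_rank B A) - int (matroid_rank M A))))"

text \<open>The first polynomial takes the geometric dual \<open>H\<close> of \<open>G\<close> as a further argument.\<close>

definition las_vergnas_ribbon ::
  "('p, 'e) ribbon \<Rightarrow> ('q, 'e) ribbon \<Rightarrow> 'r \<Rightarrow> 'r \<Rightarrow> 'r \<Rightarrow> 'r::comm_ring_1" where
  "las_vergnas_ribbon G H =
     las_vergnas (cycle_matroid G) (dual_matroid (cycle_matroid H)) (edges G)"

definition las_vergnas_delta ::
  "'e set_system \<Rightarrow> 'r \<Rightarrow> 'r \<Rightarrow> 'r \<Rightarrow> 'r::comm_ring_1" where
  "las_vergnas_delta D = las_vergnas (D_min D) (D_max D) (fst D)"

end

theory Submission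
  imports Defs
begin

text \<open>The polynomials agree because the two matroids that enter them do: for a connected ribbon graph
\<open>G\<close>, the minimum feasible sets of \<open>D(G)\<close> are the spanning trees of \<open>G\<close>, and the maximum ones are
the complements of the spanning trees of the dual (\<open>delta_matroid_matroids\<close>).

Everything takes place in the closed surface \<open>Y\<close> that arises from \<open>G\<close> by capping. It is cut into
discs, namely the vertices and edges of \<open>G\<close> and the caps, which meet only in their boundaries. By
invariance of domain, the boundary of a subsurface of \<open>Y\<close> is the part of it outside its topological
interior. For the union of some of the discs this is the intersection with the union of all the other
discs (\<open>surface_boundary_cells\<close>). That description does not change when a family of discs
is replaced by its complement; hence the spanning subgraph of \<open>G\<close> with edge set \<open>A\<close> has the same
boundary as the spanning subgraph of the dual with edge set \<open>E - A\<close>, and \<open>A\<close> is feasible for \<open>G\<close>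
exactly if \<open>E - A\<close> is feasible for the dual. Maximum feasible sets of \<open>D(G)\<close> are therefore
complements of minimum feasible sets of the dual, and only minimum feasible sets have to be identified.

This takes two facts. If the boundary of a spanning subgraph is connected, then so is the subgraph:
otherwise it splits into two closed parts, each of which meets the remaining discs since \<open>Y\<close> is
connected, and this splits the boundary (\<open>circular_spans\<close>). Conversely, the boundary of a spanning tree is
connected: the tree is built up from one vertex by attaching edges and vertices, each along a single
segment, and such a step replaces an arc of the boundary, the segment, by another arc with the same
end points (\<open>circular_attach\<close>). The point to check is that the open segment leaves the boundary, that is,
that no third disc touches it; the collars of the two discs on either side of the segment fit together to an
open set (\<open>common_segment_interior\<close>).

A set of edges that connects all vertices contains a spanning tree, and all spanning trees have the
same size, so the minimum feasible sets are the spanning trees; these in turn are the maximal forests,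
the bases of the cycle matroid.\<close>

section \<open>Invariance of domain and boundaries of subsurfaces\<close>

text \<open>Invariance of domain carries over from the plane to every surface without boundary, because near
  each point of the image the map can be composed with a chart.\<close>

lemma open_image_in_closed_surface:
  fixes f :: "complex \<Rightarrow> 'p"
  assumes Y: "surface_boundary Y = {}" and U: "open U"
    and f: "continuous_map (top_of_set U) Y f" "inj_on f U"
  shows "openin Y (f ` U)"
proof (subst openin_subopen, intro ballI)
  fix p assume "p \<in> f ` U"
  then have "p \<in> topspace Y"
    using continuous_map_image_subset_topspace[OF f(1)] by auto
  with Y obtain N W g where N: "openin Y N" "p \<in> N" and W: "open (W :: complex set)"
    and g: "homeomorphic_map (subtopology Y N) (top_of_set W) g"
    unfolding surface_boundary_def homeomorphic_space by blast
  have NY: "topspace (subtopology Y N) = N"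
    using openin_subset[OF N(1)] by auto
  have gW: "g ` N = W" "inj_on g N"
    using homeomorphic_imp_surjective_map[OF g] homeomorphic_imp_injective_map[OF g] NY by auto
  define U' where "U' = {u \<in> U. f u \<in> N}"
  have "openin (top_of_set U) U'"
    using openin_continuous_map_preimage[OF f(1) N(1)] by (simp add: U'_def)
  then have U': "open U'" "U' \<subseteq> U"
    using U openin_open_trans U'_def by auto
  have "continuous_map (top_of_set U') (subtopology Y N) f"
    using continuous_map_from_subtopology_mono[OF f(1) U'(2)]
    by (auto simp: continuous_map_in_subtopology U'_def)
  then have "continuous_map (top_of_set U') (top_of_set W) (g \<circ> f)"
    using homeomorphic_imp_continuous_map[OF g] continuous_map_compose by blast
  then have cont: "continuous_on U' (g \<circ> f)"
    by simp
  have inj: "inj_on (g \<circ> f) U'"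
    using f(2) gW(2) by (intro comp_inj_on) (auto simp: U'_def inj_on_def)
  have "open ((g \<circ> f) ` U')"
    by (rule invariance_of_domain[OF cont U'(1) inj])
  moreover have "(g \<circ> f) ` U' \<subseteq> W"
    using gW by (auto simp: U'_def)
  ultimately have "openin (top_of_set W) ((g \<circ> f) ` U')"
    by (metis open_subset)
  then have "openin (subtopology Y N) {x \<in> topspace (subtopology Y N). g x \<in> (g \<circ> f) ` U'}"
    using homeomorphic_imp_continuous_map[OF g] openin_continuous_map_preimage by blast
  moreover have "{x \<in> topspace (subtopology Y N). g x \<in> (g \<circ> f) ` U'} = f ` U'"
    using gW(2) NY by (auto simp: U'_def inj_on_def)
  ultimately have "openin Y (f ` U')"
    using N(1) openin_trans_full by fastforce
  then show "\<exists>T. openin Y T \<and> p \<in> T \<and> T \<subseteq> f ` U"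
    using \<open>p \<in> f ` U\<close> N(2) by (intro exI[of _ "f ` U'"]) (auto simp: U'_def)
qed

text \<open>If a point of \<open>K\<close> has a planar neighbourhood in \<open>K\<close>, then by invariance of domain this
  neighbourhood is open in \<open>Y\<close>. So inside a surface without boundary, the intrinsic boundary of any
  subset can be read off from the topology of \<open>Y\<close>.\<close>

lemma surface_boundary_subtopology:
  assumes Y: "surface_boundary Y = {}" and K: "K \<subseteq> topspace Y"
  shows "surface_boundary (subtopology Y K) = K - Y interior_of K"
proof -
  have "(\<exists>U W. openin (subtopology Y K) U \<and> p \<in> U \<and> open (W::complex set) \<and>
        subtopology (subtopology Y K) U homeomorphic_space top_of_set W) \<longleftrightarrow> p \<in> Y interior_of K"
    (is "?L \<longleftrightarrow> ?R") if p: "p \<in> K" for p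
  proof
    assume ?L
    then obtain U W f where U: "openin (subtopology Y K) U" "p \<in> U" "open (W::complex set)"
      and "homeomorphic_map (top_of_set W) (subtopology (subtopology Y K) U) f"
      using homeomorphic_space homeomorphic_space_sym by metis
    moreover have UK: "U \<subseteq> K"
      using openin_subset[OF U(1)] by auto
    ultimately have f: "homeomorphic_map (top_of_set W) (subtopology Y U) f"
      by (simp add: subtopology_subtopology inf_absorb2)
    have "continuous_map (top_of_set W) Y f"
      using homeomorphic_imp_continuous_map[OF f] continuous_map_in_subtopology by blast
    moreover have "inj_on f W"
      using homeomorphic_imp_injective_map[OF f] by simp
    moreover have "f ` W = U"
      using homeomorphic_imp_surjective_map[OF f] UK K by auto
    ultimately have "openin Y U"
      using open_image_in_closed_surface[OF Y U(3)] by metis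
    then show ?R
      using U(2) UK by (auto simp: interior_of_def)
  next
    assume ?R
    have "p \<in> topspace Y" using p K by auto
    with Y obtain N W g where N: "openin Y N" "p \<in> N" and W: "open (W :: complex set)"
      and g: "homeomorphic_map (subtopology Y N) (top_of_set W) g"
      unfolding surface_boundary_def homeomorphic_space by blast
    define U where "U = N \<inter> Y interior_of K"
    have U: "openin Y U" "p \<in> U" "U \<subseteq> N" "U \<subseteq> K"
      using N \<open>?R\<close> interior_of_subset[of Y K] by (auto simp: U_def)
    have "openin (subtopology Y N) U"
      by (metis N(1) U(1) U(3) openin_open_subtopology)
    then have "openin (top_of_set W) (g ` U)"
      using homeomorphic_imp_open_map[OF g] by (simp add: open_map_def)
    then have gU: "open (g ` U)" "g ` U \<subseteq> W"
      using W openin_open_trans openin_subset by fastforce+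
    have "homeomorphic_map (subtopology (subtopology Y N) U) (subtopology (top_of_set W) (g ` U)) g"
      using U gU openin_subset[OF U(1)] by (intro homeomorphic_map_subtopologies[OF g]) auto
    then have "homeomorphic_map (subtopology Y U) (top_of_set (g ` U)) g"
      using U(3) gU(2) by (simp add: subtopology_subtopology inf_absorb2)
    then have "subtopology (subtopology Y K) U homeomorphic_space top_of_set (g ` U)"
      using U(4) by (metis homeomorphic_map_imp_homeomorphic_space subtopology_subtopology inf_absorb2)
    moreover have "openin (subtopology Y K) U"
      using U by (metis inf.absorb_iff1 openin_subtopology_Int)
    ultimately show ?L
      using U(2) gU(1) by blast
  qed
  then show ?thesis
    using K by (auto simp: surface_boundary_def)
qed

lemma surface_boundary_euclidean: "surface_boundary (euclidean :: complex topology) = {}"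
  by (auto simp: surface_boundary_def intro!: exI[of _ UNIV])

lemma surface_boundary_cball:
  "surface_boundary (top_of_set (cball (0::complex) 1)) = sphere 0 1"
proof -
  have "surface_boundary (top_of_set (cball (0::complex) 1)) = cball 0 1 - interior (cball 0 1)"
    using surface_boundary_subtopology[OF surface_boundary_euclidean, of "cball 0 1"] by simp
  also have "\<dots> = sphere 0 1"
    by (auto simp: interior_cball)
  finally show ?thesis .
qed

lemma surface_boundary_homeomorphic_subset:
  assumes f: "homeomorphic_map X Z f"
  shows "f ` surface_boundary X \<subseteq> surface_boundary Z"
proof
  fix q assume "q \<in> f ` surface_boundary X"
  then obtain p where p: "q = f p" "p \<in> surface_boundary X" by auto
  have fX: "f ` topspace X = topspace Z" and inj: "inj_on f (topspace X)"
    using homeomorphic_imp_surjective_map[OF f] homeomorphic_imp_injective_map[OF f] by auto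
  have pX: "p \<in> topspace X" using p by (simp add: surface_boundary_def)
  have False if V: "openin Z V" "q \<in> V" "open (W::complex set)"
    "subtopology Z V homeomorphic_space top_of_set W" for V W
  proof -
    define U where "U = {x \<in> topspace X. f x \<in> V}"
    have U: "openin X U"
      unfolding U_def
      by (rule openin_continuous_map_preimage[OF homeomorphic_imp_continuous_map[OF f] V(1)])
    have "homeomorphic_map (subtopology X U) (subtopology Z V) f"
      by (rule homeomorphic_map_subtopologies[OF f]) (use fX openin_subset[OF V(1)] in \<open>auto simp: U_def\<close>)
    then have "subtopology X U homeomorphic_space top_of_set W"
      using V(4) homeomorphic_map_imp_homeomorphic_space homeomorphic_space_trans by blast
    then show False
      using p pX V U by (auto simp: surface_boundary_def U_def)
  qed
  then show "q \<in> surface_boundary Z"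
    using fX pX p unfolding surface_boundary_def by blast
qed

lemma surface_boundary_homeomorphic:
  assumes f: "homeomorphic_map X Z f"
  shows "surface_boundary Z = f ` surface_boundary X"
proof
  obtain g where g: "homeomorphic_maps X Z f g"
    using f homeomorphic_map_maps by blast
  then have "homeomorphic_map Z X g"
    using homeomorphic_maps_map homeomorphic_maps_sym by blast
  then have "g ` surface_boundary Z \<subseteq> surface_boundary X"
    by (rule surface_boundary_homeomorphic_subset)
  moreover have "f (g q) = q" if "q \<in> surface_boundary Z" for q
    using g that by (auto simp: homeomorphic_maps_def surface_boundary_def)
  ultimately show "surface_boundary Z \<subseteq> f ` surface_boundary X"
    by (metis (no_types, lifting) image_iff image_subset_iff subsetI)
qed (rule surface_boundary_homeomorphic_subset[OF f])

section \<open>Discs in a surface\<close>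

lemma is_disc_parametrization:
  assumes "is_disc Y c"
  obtains \<phi> where "homeomorphic_map (top_of_set (cball (0::complex) 1)) (subtopology Y c) \<phi>"
    "\<phi> ` cball 0 1 = c" "inj_on \<phi> (cball 0 1)" "\<phi> ` sphere 0 1 = disc_boundary Y c"
    "continuous_map (top_of_set (cball 0 1)) Y \<phi>"
proof -
  have cY: "c \<subseteq> topspace Y" using assms by (simp add: is_disc_def)
  obtain \<phi> where \<phi>: "homeomorphic_map (top_of_set (cball (0::complex) 1)) (subtopology Y c) \<phi>"
    using assms homeomorphic_space homeomorphic_space_sym unfolding is_disc_def by metis
  have 1: "\<phi> ` cball 0 1 = c"
    using homeomorphic_imp_surjective_map[OF \<phi>] cY by auto
  have 2: "inj_on \<phi> (cball 0 1)"
    using homeomorphic_imp_injective_map[OF \<phi>] by auto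
  have 3: "\<phi> ` sphere 0 1 = disc_boundary Y c"
    using surface_boundary_homeomorphic[OF \<phi>] by (simp add: disc_boundary_def surface_boundary_cball)
  have 4: "continuous_map (top_of_set (cball 0 1)) Y \<phi>"
    using homeomorphic_imp_continuous_map[OF \<phi>] continuous_map_in_subtopology by blast
  from that \<phi> 1 2 3 4 show thesis by blast
qed

lemma disc_boundary_subset: "is_disc Y c \<Longrightarrow> disc_boundary Y c \<subseteq> c"
  using is_disc_parametrization[of Y c] by (metis image_mono sphere_cball)

lemma disc_boundary_nonempty: "is_disc Y c \<Longrightarrow> disc_boundary Y c \<noteq> {}"
  using is_disc_parametrization[of Y c] by (metis image_is_empty sphere_eq_empty zero_le_one not_less)

lemma disc_nonempty: "is_disc Y c \<Longrightarrow> c \<noteq> {}"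
  using disc_boundary_subset disc_boundary_nonempty by fastforce

lemma compactin_disc: "is_disc Y c \<Longrightarrow> compactin Y c"
  using is_disc_parametrization[of Y c] by (metis compactin_absolute compact_cball image_compactin compactin_subtopology compactin_euclidean_iff order_refl)

lemma closedin_disc: "Hausdorff_space Y \<Longrightarrow> is_disc Y c \<Longrightarrow> closedin Y c"
  by (simp add: compactin_disc compactin_imp_closedin)

lemma connectedin_disc: "is_disc Y c \<Longrightarrow> connectedin Y c"
  using is_disc_parametrization[of Y c]
  by (metis connectedin_absolute connectedin_continuous_map_image connectedin_subtopology connected_cball connectedin_iff_connected order_refl)

lemma connectedin_disc_boundary:
  assumes "is_disc Y c" shows "connectedin Y (disc_boundary Y c)"
proof -
  obtain \<phi> where \<phi>: "\<phi> ` sphere 0 1 = disc_boundary Y c"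
    "continuous_map (top_of_set (cball (0::complex) 1)) Y \<phi>"
    using is_disc_parametrization[OF assms] by metis
  have "connectedin (top_of_set (cball (0::complex) 1)) (sphere 0 1)"
    by (auto simp: connectedin_subtopology intro: connected_sphere)
  then show ?thesis
    using \<phi> connectedin_continuous_map_image by metis
qed

lemma open_disc_minus_boundary:
  assumes Y: "surface_boundary Y = {}" and c: "is_disc Y c"
  shows "openin Y (c - disc_boundary Y c)"
proof -
  obtain \<phi> where \<phi>: "\<phi> ` cball 0 1 = c" "inj_on \<phi> (cball (0::complex) 1)"
    "\<phi> ` sphere 0 1 = disc_boundary Y c"
    "continuous_map (top_of_set (cball 0 1)) Y \<phi>"
    using is_disc_parametrization[OF c] by metis
  have "openin Y (\<phi> ` ball 0 1)"
    by (rule open_image_in_closed_surface[OF Y])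
      (use \<phi> in \<open>auto intro: continuous_map_from_subtopology_mono inj_on_subset\<close>)
  moreover have "\<phi> ` ball 0 1 = c - disc_boundary Y c"
    using inj_on_image_set_diff[OF \<phi>(2), of "cball 0 1" "sphere 0 1"] \<phi> by (simp add: sphere_cball cball_diff_sphere)
  ultimately show ?thesis by simp
qed

lemma disc_subset_closure:
  assumes c: "is_disc Y c"
  shows "c \<subseteq> Y closure_of (c - disc_boundary Y c)"
proof -
  obtain \<phi> where \<phi>: "\<phi> ` cball 0 1 = c" "inj_on \<phi> (cball (0::complex) 1)"
    "\<phi> ` sphere 0 1 = disc_boundary Y c"
    "continuous_map (top_of_set (cball 0 1)) Y \<phi>"
    using is_disc_parametrization[OF c] by metis
  have "\<phi> ` ball 0 1 = c - disc_boundary Y c"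
    using inj_on_image_set_diff[OF \<phi>(2), of "cball 0 1" "sphere 0 1"] \<phi> by (simp add: sphere_cball cball_diff_sphere)
  moreover have "\<phi> ` (top_of_set (cball 0 1) closure_of ball 0 1) \<subseteq> Y closure_of (\<phi> ` ball 0 1)"
    using \<phi>(4) by (simp add: continuous_map_image_closure_subset)
  moreover have "top_of_set (cball 0 1) closure_of ball 0 1 = cball (0::complex) 1"
    by (simp add: closure_of_subtopology Int_absorb1 ball_subset_cball)
  ultimately show ?thesis
    using \<phi>(1) by simp
qed

text \<open>The inside of \<open>c\<close> is open, and every point of \<open>d\<close> is a limit of points inside \<open>d\<close>. So the
  inside of \<open>c\<close> cannot touch \<open>d\<close> without touching the inside of \<open>d\<close>.\<close>

lemma disc_Int_subset_boundary:
  assumes Y: "surface_boundary Y = {}" and c: "is_disc Y c" and d: "is_disc Y d"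
    and "c \<inter> d \<subseteq> disc_boundary Y d"
  shows "c \<inter> d \<subseteq> disc_boundary Y c"
proof (rule ccontr)
  assume "\<not> c \<inter> d \<subseteq> disc_boundary Y c"
  then obtain p where "p \<in> c - disc_boundary Y c" "p \<in> d" by auto
  then have "(c - disc_boundary Y c) \<inter> (d - disc_boundary Y d) \<noteq> {}"
    using disc_subset_closure[OF d] open_disc_minus_boundary[OF Y c]
    by (metis disjoint_iff openin_Int_closure_of_eq_empty subsetD)
  then show False
    using assms(4) by auto
qed

text \<open>Only whether the number of boundary components is one ever matters, and this is a matter of
  connectedness, which is easier to handle than counting components.\<close>

lemma card_boundary_components_eq_1:
  "card (boundary_components X) = 1 \<longleftrightarrow>
     connectedin X (surface_boundary X) \<and> surface_boundary X \<noteq> {}"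
proof -
  have S: "topspace (subtopology X (surface_boundary X)) = surface_boundary X"
    by (auto simp: surface_boundary_def)
  have "card (boundary_components X) = 1 \<longleftrightarrow>
     connected_space (subtopology X (surface_boundary X)) \<and> surface_boundary X \<noteq> {}"
    unfolding boundary_components_def card_1_singleton_iff One_nat_def
      connected_components_of_eq_singleton
    using S by (metis null_topspace_iff_trivial)
  also have "connected_space (subtopology X (surface_boundary X)) \<longleftrightarrow> connectedin X (surface_boundary X)"
    using S by (auto simp: connectedin_def)
  finally show ?thesis .
qed

section \<open>Arcs in a circle\<close>

text \<open>An arc is contractible and a circle is not.\<close>

lemma arc_in_circle_avoids_point:
  fixes \<gamma> :: "real \<Rightarrow> complex"
  assumes cont: "continuous_on {0..1} \<gamma>" and inj: "inj_on \<gamma> {0..1}" and sph: "\<gamma> ` {0..1} \<subseteq> sphere 0 1"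
  shows "\<exists>z \<in> sphere 0 1. z \<notin> \<gamma> ` {0..1}"
proof (rule ccontr)
  assume "\<not> ?thesis"
  then have eq: "\<gamma> ` {0..1} = sphere 0 1" using sph by blast
  have "{0..1::real} homeomorphic \<gamma> ` {0..1}"
    by (rule homeomorphic_compact[OF compact_Icc cont refl inj])
  then have "contractible (sphere (0::complex) 1)"
    using eq homeomorphic_contractible convex_imp_contractible convex_real_interval(5) by metis
  then show False
    by (simp add: contractible_sphere)
qed

text \<open>Measured from a point off the arc, the angle is a continuous injective function on the arc, so it
  maps the arc onto an interval \<open>{m..M}\<close> with \<open>0 < m\<close> and \<open>M < 2 * pi\<close>. The complement of the open
  arc is then covered by the angles in \<open>{0..m}\<close> and in \<open>{M..2 * pi}\<close>, two arcs that share the base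
  point, and the end points of the arc are limits of smaller and larger angles.\<close>

lemma circle_minus_open_arc:
  fixes \<gamma> :: "real \<Rightarrow> complex"
  assumes cont: "continuous_on {0..1} \<gamma>" and inj: "inj_on \<gamma> {0..1}" and sph: "\<gamma> ` {0..1} \<subseteq> sphere 0 1"
  shows "connected (sphere 0 1 - \<gamma> ` {0<..<1})"
    and "{\<gamma> 0, \<gamma> 1} \<subseteq> closure (sphere 0 1 - \<gamma> ` {0..1})"
proof -
  obtain z where z: "z \<in> sphere 0 1" "z \<notin> \<gamma> ` {0..1}"
    using arc_in_circle_avoids_point[OF assms] by blast
  have z0: "z \<noteq> 0" "norm z = 1" using z by auto
  define E where "E t = z * exp (\<i> * of_real t)" for t :: real
  define \<alpha> where "\<alpha> t = Arg2pi (\<gamma> t / z)" for t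
  have E\<alpha>: "E (\<alpha> t) = \<gamma> t" if "t \<in> {0..1}" for t
  proof -
    have "\<gamma> t \<in> sphere 0 1" using sph that by blast
    then have "norm (\<gamma> t / z) = 1" using z0 by (simp add: norm_divide)
    then have "\<gamma> t / z = exp (\<i> * of_real (\<alpha> t))"
      using Arg2pi_eq[of "\<gamma> t / z"] by (simp add: \<alpha>_def)
    then show ?thesis using z0 by (simp add: E_def field_simps)
  qed
  have contE: "continuous_on X E" for X
    unfolding E_def by (intro continuous_intros)
  have E0: "E 0 = z" "E (2*pi) = z"
    by (auto simp: E_def mult_ac exp_eq_1 exp_two_pi_i)
  have injE: "s = t" if "E s = E t" "0 < s" "s < 2*pi" "0 \<le> t" "t \<le> 2*pi" for s t
  proof -
    have t: "t < 2*pi \<or> t = 2*pi" using that by auto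
    have "Arg2pi (exp (\<i> * of_real s)) = s" using that by (subst Arg2pi_exp) auto
    moreover have "exp (\<i> * of_real s) = exp (\<i> * of_real t)" using that z0 by (simp add: E_def)
    moreover have "t < 2*pi \<Longrightarrow> Arg2pi (exp (\<i> * of_real t)) = t" using that by (subst Arg2pi_exp) auto
    moreover have "t = 2*pi \<Longrightarrow> exp (\<i> * of_real t) = 1" by (simp add: mult_ac exp_two_pi_i)
    moreover have "Arg2pi 1 = 0" by (simp add: Arg2pi_eq_0)
    ultimately show ?thesis using t that(2) by (metis less_irrefl)
  qed
  have \<alpha>bd: "0 < \<alpha> t" "\<alpha> t < 2*pi" if "t \<in> {0..1}" for t
  proof -
    have "\<alpha> t \<noteq> 0" using E\<alpha>[OF that] E0 z that by (metis imageI)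
    then show "0 < \<alpha> t" "\<alpha> t < 2*pi"
      unfolding \<alpha>_def using Arg2pi_ge_0[of "\<gamma> t / z"] Arg2pi_lt_2pi[of "\<gamma> t / z"] by linarith+
  qed
  have cont\<alpha>: "continuous_on {0..1} \<alpha>"
    unfolding \<alpha>_def
  proof (rule continuous_on_compose2[where g=Arg2pi and t="- \<real>\<^sub>\<ge>\<^sub>0"])
    show "continuous_on (- \<real>\<^sub>\<ge>\<^sub>0) Arg2pi"
      using continuous_at_Arg2pi continuous_at_imp_continuous_on by blast
    show "continuous_on {0..1} (\<lambda>t. \<gamma> t / z)"
      by (intro continuous_intros cont) (use z0 in auto)
    show "(\<lambda>t. \<gamma> t / z) ` {0..1} \<subseteq> - \<real>\<^sub>\<ge>\<^sub>0"
    proof (rule image_subsetI)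
      fix t :: real assume "t \<in> {0..1}"
      then have "Arg2pi (\<gamma> t / z) \<noteq> 0" using \<alpha>bd(1)[of t] by (simp add: \<alpha>_def)
      then show "\<gamma> t / z \<in> - \<real>\<^sub>\<ge>\<^sub>0"
        by (auto simp: complex_nonneg_Reals_iff complex_is_Real_iff Arg2pi_eq_0)
    qed
  qed
  have inj\<alpha>: "inj_on \<alpha> {0..1}"
  proof (rule inj_onI)
    fix t u assume tu: "t \<in> {0..1}" "u \<in> {0..1}" "\<alpha> t = \<alpha> u"
    then have "\<gamma> t = \<gamma> u" using E\<alpha>[of t] E\<alpha>[of u] by simp
    then show "t = u" using inj_onD[OF inj] tu by blast
  qed
  define m where "m = min (\<alpha> 0) (\<alpha> 1)"
  define M where "M = max (\<alpha> 0) (\<alpha> 1)"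
  have mM: "0 < m" "m < M" "M < 2*pi" and mM_set: "{\<alpha> 0, \<alpha> 1} = {m, M}"
    using \<alpha>bd[of 0] \<alpha>bd[of 1] inj_onD[OF inj\<alpha>, of 0 1]
    by (auto simp: m_def M_def min_def max_def order_less_le)
  have im: "\<alpha> ` {0<..<1} = {m<..<M}"
  proof (intro set_eqI iffI)
    fix y assume "y \<in> \<alpha> ` {0<..<1}"
    then obtain t where t: "y = \<alpha> t" "0 < t" "t < 1" by auto
    then show "y \<in> {m<..<M}"
      using continuous_inj_imp_mono[OF t(2,3) cont\<alpha> inj\<alpha>] by (auto simp: m_def M_def)
  next
    fix y assume y: "y \<in> {m<..<M}"
    have "connected (\<alpha> ` {0..1})"
      using cont\<alpha> by (simp add: connected_continuous_image)
    moreover have "m \<in> \<alpha> ` {0..1}" "M \<in> \<alpha> ` {0..1}"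
      by (auto simp: m_def M_def min_def max_def)
    ultimately have "y \<in> \<alpha> ` {0..1}"
      using y by (meson connectedD_interval greaterThanLessThan_iff less_imp_le)
    then obtain t where t: "y = \<alpha> t" "t \<in> {0..1}" by auto
    moreover have "y \<noteq> \<alpha> 0" "y \<noteq> \<alpha> 1"
      using y mM_set by (metis greaterThanLessThan_iff insertI1 insert_commute insertE less_irrefl singletonD)+
    ultimately have "t \<noteq> 0" "t \<noteq> 1" by auto
    with t show "y \<in> \<alpha> ` {0<..<1}" by auto
  qed
  have surjE: "\<exists>t \<in> {0..2*pi}. w = E t" if "w \<in> sphere 0 1" for w
  proof -
    have "norm (w / z) = 1" using that z0 by (auto simp: norm_divide)
    then have "w / z = exp (\<i> * of_real (Arg2pi (w/z)))"
      using Arg2pi_eq[of "w / z"] by simp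
    then have "w = E (Arg2pi (w/z))" using z0 by (simp add: E_def field_simps)
    then show ?thesis
      using Arg2pi_ge_0[of "w/z"] Arg2pi_lt_2pi[of "w/z"] by fastforce
  qed
  have Esph: "E t \<in> sphere 0 1" for t
    using z0 by (simp add: E_def norm_mult)
  have open_arc: "\<gamma> ` {0<..<1} = E ` {m<..<M}"
    unfolding im[symmetric] image_image using E\<alpha> by (intro image_cong) auto
  have "{\<gamma> 0, \<gamma> 1} = E ` {\<alpha> 0, \<alpha> 1}" using E\<alpha> by auto
  then have ends: "{\<gamma> 0, \<gamma> 1} = {E m, E M}" using mM_set by auto
  have "{0..1} = {0<..<1} \<union> {0, 1::real}" by auto
  then have "\<gamma> ` {0..1} = \<gamma> ` {0<..<1} \<union> {\<gamma> 0, \<gamma> 1}" by (metis image_Un image_insert image_empty)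
  then have "\<gamma> ` {0..1} = E ` ({m<..<M} \<union> {m, M})"
    using open_arc ends by (simp add: image_Un)
  moreover have "{m<..<M} \<union> {m, M} = {m..M}" using mM by auto
  ultimately have arc: "\<gamma> ` {0..1} = E ` {m..M}" by (simp only:)
  have compl: "sphere 0 1 - E ` X = E ` ({0..2*pi} - X)" if X: "X \<subseteq> {m..M}" for X
  proof (intro set_eqI iffI)
    fix w assume w: "w \<in> sphere 0 1 - E ` X"
    then obtain t where "t \<in> {0..2*pi}" "w = E t" using surjE by blast
    then show "w \<in> E ` ({0..2*pi} - X)" using w by blast
  next
    fix w assume "w \<in> E ` ({0..2*pi} - X)"
    then obtain t where t: "w = E t" "t \<in> {0..2*pi}" "t \<notin> X" by blast
    have "E s \<noteq> E t" if "s \<in> X" for s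
    proof
      assume "E s = E t"
      moreover have "0 < s" "s < 2*pi" using X that mM by force+
      ultimately have "s = t" using injE t(2) by auto
      then show False using that t(3) by simp
    qed
    then show "w \<in> sphere 0 1 - E ` X" using Esph t(1) by blast
  qed
  have gap: "{0..2*pi} - {m<..<M} = {0..m} \<union> {M..2*pi}" using mM by auto
  have "{m<..<M} \<subseteq> {m..M}" by auto
  then have "sphere 0 1 - \<gamma> ` {0<..<1} = E ` {0..m} \<union> E ` {M..2*pi}"
    by (simp only: open_arc compl gap image_Un)
  moreover have "connected (E ` {0..m} \<union> E ` {M..2*pi})"
  proof (rule connected_Un)
    have "z \<in> E ` {0..m}" using E0(1) mM by force
    moreover have "z \<in> E ` {M..2*pi}" using E0(2) mM by force
    ultimately show "E ` {0..m} \<inter> E ` {M..2*pi} \<noteq> {}" by blast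
  qed (auto intro: connected_continuous_image contE)
  ultimately show "connected (sphere 0 1 - \<gamma> ` {0<..<1})" by simp
  have "E ` closure ({0..2*pi} - {m..M}) \<subseteq> closure (E ` ({0..2*pi} - {m..M}))"
    by (rule continuous_image_closure_subset[OF contE subset_UNIV])
  moreover have "m \<in> closure {0<..<m}" "M \<in> closure {M<..<2*pi}"
    using mM by auto
  then have "m \<in> closure ({0..2*pi} - {m..M})" "M \<in> closure ({0..2*pi} - {m..M})"
    using mM closure_mono[of "{0<..<m}" "{0..2*pi} - {m..M}"] closure_mono[of "{M<..<2*pi}" "{0..2*pi} - {m..M}"]
    by (auto simp: subset_iff)
  ultimately show "{\<gamma> 0, \<gamma> 1} \<subseteq> closure (sphere 0 1 - \<gamma> ` {0..1})"
    unfolding ends arc compl[OF order_refl] by blast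
qed

section \<open>Gluing two discs along a segment\<close>

text \<open>The map from \<open>(r, u)\<close> to \<open>(1 - r) * u\<close> gives coordinates in the disc near its boundary: the depth
  \<open>r\<close> below the boundary and the boundary point \<open>u\<close>.\<close>

lemma collar_coordinates:
  fixes u v :: complex and r s :: real
  assumes "norm u = 1" "norm v = 1" "0 \<le> r" "r < 1" "0 \<le> s" "s < 1" "of_real (1 - r) * u = of_real (1 - s) * v"
  shows "r = s" "u = v"
proof -
  have "norm (of_real (1 - r) * u) = 1 - r" "norm (of_real (1 - s) * v) = 1 - s"
    using assms(1-6) by (simp_all add: norm_mult del: of_real_diff)
  then show "r = s" using assms(7) by simp
  then show "u = v" using assms by simp
qed

lemma is_segment_parametrization:
  assumes "is_segment Y s"
  obtains \<gamma> where "continuous_map (top_of_set {0..1::real}) (subtopology Y s) \<gamma>" "inj_on \<gamma> {0..1}" "\<gamma> ` {0..1} = s"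
proof -
  obtain \<gamma> where \<gamma>: "homeomorphic_map (top_of_set {0..1::real}) (subtopology Y s) \<gamma>"
    using assms homeomorphic_space homeomorphic_space_sym unfolding is_segment_def by metis
  have "\<gamma> ` {0..1} = s"
    using homeomorphic_imp_surjective_map[OF \<gamma>] assms by (auto simp: is_segment_def)
  then show thesis
    using that homeomorphic_imp_injective_map[OF \<gamma>] homeomorphic_imp_continuous_map[OF \<gamma>] by auto
qed

lemma is_segment_nonempty: "is_segment Y s \<Longrightarrow> s \<noteq> {}"
  using is_segment_parametrization[of Y s] by (metis atLeastAtMost_iff empty_iff image_is_empty order_refl zero_le_one)

lemma disc_boundary_arc_pullback:
  assumes \<phi>: "homeomorphic_map (top_of_set (cball (0::complex) 1)) (subtopology Y c) \<phi>"
    "\<phi> ` cball 0 1 = c" "inj_on \<phi> (cball 0 1)" "\<phi> ` sphere 0 1 = B"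
    and \<gamma>: "continuous_map (top_of_set {0..1::real}) (subtopology Y s) \<gamma>" "inj_on \<gamma> {0..1}" "\<gamma> ` {0..1} = s"
    and s: "s \<subseteq> B"
  obtains \<delta> where "continuous_on {0..1} \<delta>" "inj_on \<delta> {0..1}" "\<delta> ` {0..1} \<subseteq> sphere 0 1"
    "\<And>t. t \<in> {0..1} \<Longrightarrow> \<phi> (\<delta> t) = \<gamma> t"
proof -
  obtain \<psi> where \<psi>: "homeomorphic_maps (top_of_set (cball (0::complex) 1)) (subtopology Y c) \<phi> \<psi>"
    using \<phi>(1) homeomorphic_map_maps by blast
  have sc: "s \<subseteq> c" using s \<phi> sphere_cball[of "0::complex" 1] by blast
  have "continuous_map (top_of_set {0..1::real}) (subtopology Y c) \<gamma>"
    using \<gamma>(1) sc by (auto simp: continuous_map_in_subtopology)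
  then have "continuous_map (top_of_set {0..1::real}) (top_of_set (cball 0 1)) (\<psi> \<circ> \<gamma>)"
    using \<psi> continuous_map_compose unfolding homeomorphic_maps_def by blast
  then have 1: "continuous_on {0..1} (\<psi> \<circ> \<gamma>)" by auto
  have cY: "topspace (subtopology Y c) = c"
    using homeomorphic_imp_surjective_map[OF \<phi>(1)] \<phi>(2) by auto
  have 2: "\<phi> ((\<psi> \<circ> \<gamma>) t) = \<gamma> t" if "t \<in> {0..1}" for t
  proof -
    have "\<gamma> t \<in> c" using that \<gamma>(3) sc by blast
    then show ?thesis using \<psi> cY unfolding homeomorphic_maps_def by simp
  qed
  have 3: "inj_on (\<psi> \<circ> \<gamma>) {0..1}"
  proof (rule inj_onI)
    fix t u assume tu: "t \<in> {0..1}" "u \<in> {0..1}" "(\<psi> \<circ> \<gamma>) t = (\<psi> \<circ> \<gamma>) u"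
    then have "\<gamma> t = \<gamma> u" using 2[of t] 2[of u] by simp
    then show "t = u" using inj_onD[OF \<gamma>(2)] tu by blast
  qed
  have 4: "(\<psi> \<circ> \<gamma>) t \<in> sphere 0 1" if "t \<in> {0..1}" for t
  proof -
    have "\<gamma> t \<in> \<phi> ` sphere 0 1" unfolding \<phi>(4) using that s \<gamma>(3) by blast
    then obtain w where w: "w \<in> sphere 0 1" "\<phi> w = \<gamma> t" by (metis imageE)
    then have "w \<in> cball 0 1" by simp
    then have "\<psi> (\<phi> w) = w" using \<psi> unfolding homeomorphic_maps_def by simp
    then have "\<psi> (\<gamma> t) = w" using w(2) by simp
    then show ?thesis using w by simp
  qed
  show thesis using that[of "\<psi> \<circ> \<gamma>"] 1 2 3 4 by blast
qed

text \<open>The collar of \<open>c\<close> along the open segment is a half-open rectangle, and so is that of \<open>d\<close>. Both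
  can be parametrized so that they agree on the segment, by the position \<open>t\<close> along the segment and the
  depth below it. Put together, they form an injective image of an open rectangle, which is open by
  invariance of domain.\<close>

lemma common_segment_interior:
  assumes Y: "surface_boundary Y = {}" and c: "is_disc Y c" and d: "is_disc Y d"
    and cd: "c \<inter> d \<subseteq> disc_boundary Y c" "c \<inter> d \<subseteq> disc_boundary Y d"
    and \<gamma>: "continuous_map (top_of_set {0..1::real}) (subtopology Y s) \<gamma>" "inj_on \<gamma> {0..1}" "\<gamma> ` {0..1} = s"
    and s: "s \<subseteq> c \<inter> d"
  shows "\<gamma> ` {0<..<1} \<subseteq> Y interior_of (c \<union> d)"
proof -
  obtain \<phi> where \<phi>: "homeomorphic_map (top_of_set (cball (0::complex) 1)) (subtopology Y c) \<phi>" "\<phi> ` cball 0 1 = c" "inj_on \<phi> (cball (0::complex) 1)"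
    "\<phi> ` sphere 0 1 = disc_boundary Y c" "continuous_map (top_of_set (cball 0 1)) Y \<phi>"
    using is_disc_parametrization[OF c] by metis
  obtain \<psi> where \<psi>: "homeomorphic_map (top_of_set (cball (0::complex) 1)) (subtopology Y d) \<psi>" "\<psi> ` cball 0 1 = d" "inj_on \<psi> (cball (0::complex) 1)"
    "\<psi> ` sphere 0 1 = disc_boundary Y d" "continuous_map (top_of_set (cball 0 1)) Y \<psi>"
    using is_disc_parametrization[OF d] by metis
  obtain \<delta> where \<delta>: "continuous_on {0..1} \<delta>" "inj_on \<delta> {0..1}" "\<delta> ` {0..1} \<subseteq> sphere 0 1"
    "\<And>t. t \<in> {0..1} \<Longrightarrow> \<phi> (\<delta> t) = \<gamma> t"
    using disc_boundary_arc_pullback[OF \<phi>(1-4) \<gamma>] s cd by blast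
  obtain \<epsilon> where \<epsilon>: "continuous_on {0..1} \<epsilon>" "inj_on \<epsilon> {0..1}" "\<epsilon> ` {0..1} \<subseteq> sphere 0 1"
    "\<And>t. t \<in> {0..1} \<Longrightarrow> \<psi> (\<epsilon> t) = \<gamma> t"
    using disc_boundary_arc_pullback[OF \<psi>(1-4) \<gamma>] s cd by blast
  \<comment> \<open>\<open>Re w\<close> is the position along the segment; \<open>Im w\<close> is the depth, taken positive in \<open>c\<close> and
    negative in \<open>d\<close>\<close>
  define U where "U = {w. 0 < Re w \<and> Re w < 1 \<and> -1 < Im w \<and> Im w < 1}"
  have U: "open U"
    unfolding U_def
    by (intro open_Collect_conj open_Collect_less continuous_intros)
  define F where "F w = \<phi> (of_real (1 - Im w) * \<delta> (Re w))" for w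
  define G where "G w = \<psi> (of_real (1 - (- Im w)) * \<epsilon> (Re w))" for w
  define H where "H w = (if 0 \<le> Im w then F w else G w)" for w
  have norm\<delta>: "norm (\<delta> t) = 1" "norm (\<epsilon> t) = 1" if "0 < t" "t < 1" for t
    using \<delta>(3) \<epsilon>(3) that by (auto simp: image_subset_iff)
  have incball: "of_real (1 - r) * u \<in> cball 0 1" if "norm u = 1" "0 \<le> r" "r < 1" for r and u :: complex
    using that by (auto simp: norm_mult simp del: of_real_diff)
  have inball: "of_real (1 - r) * u \<in> ball 0 1" if "norm u = 1" "0 < r" "r < 1" for r and u :: complex
    using that by (auto simp: norm_mult simp del: of_real_diff)
  have contF: "continuous_map (top_of_set (U \<inter> {w. 0 \<le> Im w})) Y F"
    unfolding F_def
  proof (rule continuous_map_compose[where g=\<phi>, unfolded comp_def, OF _ \<phi>(5)])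
    have "continuous_on (U \<inter> {w. 0 \<le> Im w}) (\<lambda>w. of_real (1 - Im w) * \<delta> (Re w))"
      by (intro continuous_intros continuous_on_compose2[OF \<delta>(1)]) (auto simp: U_def)
    then show "continuous_map (top_of_set (U \<inter> {w. 0 \<le> Im w})) (top_of_set (cball 0 1)) (\<lambda>w. of_real (1 - Im w) * \<delta> (Re w))"
      using incball norm\<delta> by (auto simp: U_def simp del: of_real_diff mem_cball)
  qed
  have contG: "continuous_map (top_of_set (U \<inter> {w. Im w \<le> 0})) Y G"
    unfolding G_def
  proof (rule continuous_map_compose[where g=\<psi>, unfolded comp_def, OF _ \<psi>(5)])
    have "continuous_on (U \<inter> {w. Im w \<le> 0}) (\<lambda>w. of_real (1 - (- Im w)) * \<epsilon> (Re w))"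
      by (intro continuous_intros continuous_on_compose2[OF \<epsilon>(1)]) (auto simp: U_def)
    then show "continuous_map (top_of_set (U \<inter> {w. Im w \<le> 0})) (top_of_set (cball 0 1)) (\<lambda>w. of_real (1 - (- Im w)) * \<epsilon> (Re w))"
      using incball[of _ "- Im _"] norm\<delta> by (auto simp: U_def simp del: of_real_diff mem_cball)
  qed
  have contH: "continuous_map (top_of_set U) Y H"
    unfolding H_def
  proof (rule continuous_map_cases_le)
    show "continuous_map (subtopology (top_of_set U) {x \<in> topspace (top_of_set U). 0 \<le> Im x}) Y F"
      using contF by (simp add: subtopology_subtopology Collect_conj_eq inf_assoc[symmetric])
    show "continuous_map (subtopology (top_of_set U) {x \<in> topspace (top_of_set U). Im x \<le> 0}) Y G"
      using contG by (simp add: subtopology_subtopology Collect_conj_eq inf_assoc[symmetric])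
    show "F x = G x" if "x \<in> topspace (top_of_set U)" "0 = Im x" for x
      using that \<delta>(4) \<epsilon>(4) by (auto simp: F_def G_def U_def)
  qed (auto intro: continuous_intros)
  have Fc: "F w \<in> c" if "w \<in> U" "0 \<le> Im w" for w
    using that incball[of "\<delta> (Re w)" "Im w"] norm\<delta> \<phi>(2) unfolding F_def U_def by blast
  have Gd: "G w \<in> d - disc_boundary Y d" if w: "w \<in> U" "Im w < 0" for w
  proof -
    let ?v = "of_real (1 - (- Im w)) * \<epsilon> (Re w)"
    have v: "?v \<in> ball 0 1"
      using w inball[of "\<epsilon> (Re w)" "- Im w"] norm\<delta> unfolding U_def by simp
    have "\<psi> ?v \<notin> \<psi> ` sphere 0 1"
      using inj_on_image_mem_iff[OF \<psi>(3), of ?v "sphere 0 1"] v by (auto simp: sphere_cball)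
    then show ?thesis
      using v \<psi>(2,4) unfolding G_def by (metis DiffI ball_subset_cball image_eqI subsetD)
  qed
  have inj: "inj_on H U"
  proof (rule inj_onI)
    fix x y assume xy: "x \<in> U" "y \<in> U" "H x = H y"
    then have bx: "0 < Re x" "Re x < 1" "-1 < Im x" "Im x < 1" and by': "0 < Re y" "Re y < 1" "-1 < Im y" "Im y < 1"
      by (auto simp: U_def)
    have F0: "F w \<noteq> G w'" if "w \<in> U" "0 \<le> Im w" "w' \<in> U" "Im w' < 0" for w w'
      using Fc[OF that(1,2)] Gd[OF that(3,4)] cd by (metis DiffE IntI subsetD)
    consider "0 \<le> Im x" "0 \<le> Im y" | "Im x < 0" "Im y < 0"
      using F0 xy unfolding H_def by (metis not_less)
    then show "x = y"
    proof cases
      case 1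
      then have "of_real (1 - Im x) * \<delta> (Re x) = of_real (1 - Im y) * \<delta> (Re y)"
        using xy(3) \<phi>(3) incball[of "\<delta> (Re x)" "Im x"] incball[of "\<delta> (Re y)" "Im y"] norm\<delta> bx by'
        unfolding H_def F_def by (simp add: inj_on_eq_iff del: of_real_diff mem_cball)
      then have "Im x = Im y" "\<delta> (Re x) = \<delta> (Re y)"
        using collar_coordinates 1 norm\<delta> bx by' by metis+
      then show ?thesis
        using inj_onD[OF \<delta>(2), of "Re x" "Re y"] bx by' by (simp add: complex_eq_iff)
    next
      case 2
      then have "of_real (1 - (- Im x)) * \<epsilon> (Re x) = of_real (1 - (- Im y)) * \<epsilon> (Re y)"
        using xy(3) \<psi>(3) incball[of "\<epsilon> (Re x)" "- Im x"] incball[of "\<epsilon> (Re y)" "- Im y"] norm\<delta> bx by'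
        unfolding H_def G_def by (simp add: inj_on_eq_iff del: of_real_diff mem_cball)
      moreover have "0 \<le> - Im x" "0 \<le> - Im y" "- Im x < 1" "- Im y < 1" using 2 bx by' by auto
      ultimately have "- Im x = - Im y" "\<epsilon> (Re x) = \<epsilon> (Re y)"
        using collar_coordinates norm\<delta> bx(1,2) by'(1,2) by metis+
      then show ?thesis
        using inj_onD[OF \<epsilon>(2), of "Re x" "Re y"] bx by' by (simp add: complex_eq_iff)
    qed
  qed
  have "openin Y (H ` U)"
    by (rule open_image_in_closed_surface[OF Y U contH inj])
  moreover have "H ` U \<subseteq> c \<union> d"
    using Fc Gd by (auto simp: H_def not_le)
  ultimately have "H ` U \<subseteq> Y interior_of (c \<union> d)"
    by (simp add: interior_of_maximal)
  moreover have "\<gamma> t \<in> H ` U" if "t \<in> {0<..<1}" for t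
  proof
    show "\<gamma> t = H (of_real t)" using that \<delta>(4) by (simp add: H_def F_def)
    show "of_real t \<in> U" using that by (simp add: U_def)
  qed
  ultimately show ?thesis by blast
qed

text \<open>In a separation of \<open>R \<union> b\<close> the connected set \<open>b\<close> lies on one side. Replacing \<open>b\<close> by \<open>s\<close> on that
  side would turn it into a separation of \<open>s \<union> R\<close>, since \<open>s\<close> meets \<open>R\<close> only in points of \<open>b\<close>.\<close>

lemma connectedin_replace_arc:
  assumes cl: "closedin Y R" "closedin Y s" "closedin Y b"
    and C: "connectedin Y (s \<union> R)" and b: "connectedin Y b" "b \<noteq> {}" and s: "s \<noteq> {}" and Rs: "R \<inter> s \<subseteq> b"
  shows "connectedin Y (R \<union> b)"
proof -
  have False if P: "closedin Y P" and Q: "closedin Y Q" and cov: "R \<union> b \<subseteq> P \<union> Q"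
    and dis: "P \<inter> Q \<inter> (R \<union> b) = {}" and ne: "Q \<inter> (R \<union> b) \<noteq> {}" and bP: "b \<subseteq> P" for P Q
  proof -
    have "\<not> (s \<union> R \<subseteq> (s \<union> (P \<inter> R)) \<union> (Q \<inter> R) \<and> (s \<union> (P \<inter> R)) \<inter> (Q \<inter> R) \<inter> (s \<union> R) = {} \<and>
      (s \<union> (P \<inter> R)) \<inter> (s \<union> R) \<noteq> {} \<and> (Q \<inter> R) \<inter> (s \<union> R) \<noteq> {})"
      using C cl P Q unfolding connectedin_closedin by (metis closedin_Int closedin_Un)
    moreover have "s \<union> R \<subseteq> (s \<union> (P \<inter> R)) \<union> (Q \<inter> R)" using cov by blast
    moreover have "(s \<union> (P \<inter> R)) \<inter> (Q \<inter> R) \<inter> (s \<union> R) = {}" using dis bP Rs by blast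
    moreover have "(s \<union> (P \<inter> R)) \<inter> (s \<union> R) \<noteq> {}" using s by blast
    moreover have "(Q \<inter> R) \<inter> (s \<union> R) \<noteq> {}" using ne dis bP by blast
    ultimately show False by blast
  qed note * = this
  have "b \<subseteq> P \<or> b \<subseteq> Q" if "closedin Y P" "closedin Y Q" "R \<union> b \<subseteq> P \<union> Q" "P \<inter> Q \<inter> (R \<union> b) = {}" for P Q
  proof -
    have "\<not> (b \<subseteq> P \<union> Q \<and> P \<inter> Q \<inter> b = {} \<and> P \<inter> b \<noteq> {} \<and> Q \<inter> b \<noteq> {})"
      using b(1) that unfolding connectedin_closedin by blast
    then show ?thesis using that by blast
  qed
  then have "False" if "closedin Y P" "closedin Y Q" "R \<union> b \<subseteq> P \<union> Q" "P \<inter> Q \<inter> (R \<union> b) = {}"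
      "P \<inter> (R \<union> b) \<noteq> {}" "Q \<inter> (R \<union> b) \<noteq> {}" for P Q
    using *[of P Q] *[of Q P] that by (metis inf_commute sup_commute)
  moreover have "R \<union> b \<subseteq> topspace Y"
    using cl closedin_subset by blast
  ultimately show ?thesis
    unfolding connectedin_closedin by blast
qed

section \<open>Surfaces without boundary that are cut into discs\<close>

text \<open>The discs carry indices because families of them have to be complemented. The condition \<open>meet\<close> is
  used with \<open>i\<close> and \<open>j\<close> exchanged as well, so the intersection of two cells lies in both boundaries.\<close>

locale cell_decomposition =
  fixes Y :: "'q topology" and C :: "'i set" and cell :: "'i \<Rightarrow> 'q set"
  assumes Hausdorff: "Hausdorff_space Y" and no_boundary: "surface_boundary Y = {}"
    and finite_cells: "finite C"
    and disc: "i \<in> C \<Longrightarrow> is_disc Y (cell i)"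
    and cover: "topspace Y = \<Union>(cell ` C)"
    and meet: "i \<in> C \<Longrightarrow> j \<in> C \<Longrightarrow> i \<noteq> j \<Longrightarrow> cell i \<inter> cell j \<subseteq> disc_boundary Y (cell i)"
begin

text \<open>This is the boundary of the union of the cells in \<open>I\<close>, by \<open>surface_boundary_cells\<close>. The formula
  is symmetric in \<open>I\<close> and \<open>C - I\<close>, which is where duality comes from.\<close>

definition interface :: "'i set \<Rightarrow> 'q set" where
  "interface I = \<Union>(cell ` I) \<inter> \<Union>(cell ` (C - I))"

text \<open>The union of the cells in \<open>I\<close> has exactly one boundary component.\<close>

definition circular :: "'i set \<Rightarrow> bool" where
  "circular I \<longleftrightarrow> connectedin Y (interface I) \<and> interface I \<noteq> {}"

lemma closedin_cells: "I \<subseteq> C \<Longrightarrow> closedin Y (\<Union>(cell ` I))"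
  using finite_subset[OF _ finite_cells] disc closedin_disc[OF Hausdorff]
  by (intro closedin_Union) auto

text \<open>The inside of the cell misses the other cells, and it is dense in the cell.\<close>

lemma cell_avoids_interior:
  assumes I: "I \<subseteq> C" and i: "i \<in> C - I"
  shows "cell i \<inter> Y interior_of \<Union>(cell ` I) = {}"
proof -
  have "(cell i - disc_boundary Y (cell i)) \<inter> \<Union>(cell ` I) = {}"
    using meet[of i] i I by fastforce
  then have "Y interior_of \<Union>(cell ` I) \<inter> (cell i - disc_boundary Y (cell i)) = {}"
    using interior_of_subset[of Y "\<Union>(cell ` I)"] by blast
  then have "Y interior_of \<Union>(cell ` I) \<inter> Y closure_of (cell i - disc_boundary Y (cell i)) = {}"
    by (simp add: openin_Int_closure_of_eq_empty)
  then show ?thesis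
    using disc_subset_closure[OF disc] i by blast
qed

lemma surface_boundary_cells:
  assumes I: "I \<subseteq> C"
  shows "surface_boundary (subtopology Y (\<Union>(cell ` I))) = interface I"
proof -
  have sub: "\<Union>(cell ` I) \<subseteq> topspace Y" using cover I by blast
  have "openin Y (topspace Y - \<Union>(cell ` (C - I)))"
    using closedin_cells[of "C - I"] by blast
  moreover have "topspace Y - \<Union>(cell ` (C - I)) \<subseteq> \<Union>(cell ` I)"
    using cover by blast
  ultimately have "topspace Y - \<Union>(cell ` (C - I)) \<subseteq> Y interior_of \<Union>(cell ` I)"
    by (simp add: interior_of_maximal)
  moreover have "Y interior_of \<Union>(cell ` I) \<inter> \<Union>(cell ` (C - I)) = {}"
    using cell_avoids_interior[OF I] by blast
  ultimately show ?thesis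
    unfolding surface_boundary_subtopology[OF no_boundary sub] interface_def using sub by blast
qed

lemma circular_single:
  assumes "i \<in> C" shows "circular {i}"
proof -
  have "interface {i} = disc_boundary Y (cell i)"
    using surface_boundary_cells[of "{i}"] assms by (simp add: disc_boundary_def)
  then show ?thesis
    using disc[OF assms] by (simp add: circular_def connectedin_disc_boundary disc_boundary_nonempty)
qed

text \<open>Attaching the cell \<open>i\<close> along the segment \<open>s\<close> replaces \<open>s\<close>, as a part of the boundary, by the arc \<open>b\<close>
  that is left of the boundary circle of the cell. No other cell touches the open segment, since it lies
  in the interior of \<open>cell i \<union> cell j\<close>. Hence \<open>b\<close> meets \<open>s\<close> precisely in its end points.\<close>

lemma circular_attach:
  assumes I: "I \<subseteq> C" and i: "i \<in> C - I" and j: "j \<in> I"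
    and s: "cell i \<inter> \<Union>(cell ` I) = s" "s \<subseteq> cell j" "is_segment Y s" and circ: "circular I"
  shows "circular (insert i I)"
proof -
  define rest where "rest = \<Union>(cell ` (C - insert i I))"
  define R where "R = \<Union>(cell ` I) \<inter> rest"
  define b where "b = cell i \<inter> rest"
  have cl: "closedin Y rest" "closedin Y (cell i)" "closedin Y (\<Union>(cell ` I))"
    using closedin_cells[of "C - insert i I"] closedin_cells[of "{i}"] closedin_cells[OF I] i
    by (auto simp: rest_def)
  have "C - I = insert i (C - insert i I)" using i by auto
  then have bdI: "interface I = s \<union> R"
    using s(1) unfolding interface_def R_def rest_def by auto
  have "C - {i} = I \<union> (C - insert i I)" using i I by auto
  then have "interface {i} = s \<union> b"
    using s(1) unfolding interface_def b_def rest_def by auto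
  then have bdi: "disc_boundary Y (cell i) = s \<union> b"
    using surface_boundary_cells[of "{i}"] i by (simp add: disc_boundary_def)
  have bdI': "interface (insert i I) = R \<union> b"
    unfolding interface_def b_def R_def rest_def by auto
  obtain \<gamma> where \<gamma>: "continuous_map (top_of_set {0..1::real}) (subtopology Y s) \<gamma>" "inj_on \<gamma> {0..1}" "\<gamma> ` {0..1} = s"
    using is_segment_parametrization[OF s(3)] by metis
  have ij: "i \<in> C" "j \<in> C" "i \<noteq> j" using i j I by auto
  have "\<gamma> ` {0<..<1} \<subseteq> Y interior_of (cell i \<union> cell j)"
    using common_segment_interior[OF no_boundary disc[OF ij(1)] disc[OF ij(2)] _ _ \<gamma>] meet ij s by blast
  moreover have "rest \<inter> Y interior_of (cell i \<union> cell j) = {}"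
    using cell_avoids_interior[of "{i, j}"] ij j unfolding rest_def by auto
  ultimately have open_arc: "\<gamma> ` {0<..<1} \<inter> rest = {}" by blast
  obtain \<phi> where \<phi>: "homeomorphic_map (top_of_set (cball (0::complex) 1)) (subtopology Y (cell i)) \<phi>" "\<phi> ` cball 0 1 = cell i" "inj_on \<phi> (cball (0::complex) 1)"
    "\<phi> ` sphere 0 1 = disc_boundary Y (cell i)" "continuous_map (top_of_set (cball 0 1)) Y \<phi>"
    using is_disc_parametrization[OF disc[OF ij(1)]] by metis
  have "s \<subseteq> disc_boundary Y (cell i)" using bdi by blast
  then obtain \<delta> where \<delta>: "continuous_on {0..1} \<delta>" "inj_on \<delta> {0..1}" "\<delta> ` {0..1} \<subseteq> sphere 0 1"
    "\<And>t. t \<in> {0..1} \<Longrightarrow> \<phi> (\<delta> t) = \<gamma> t"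
    using disc_boundary_arc_pullback[OF \<phi>(1-4) \<gamma>] by metis
  have image_diff: "\<phi> ` (sphere 0 1 - \<delta> ` X) = disc_boundary Y (cell i) - \<gamma> ` X" if "X \<subseteq> {0..1}" for X
  proof -
    have "\<phi> ` (\<delta> ` X) = \<gamma> ` X"
      unfolding image_image using \<delta>(4) that by (intro image_cong) auto
    moreover have "\<delta> ` X \<subseteq> cball 0 1" using \<delta>(3) that sphere_cball by blast
    moreover have "sphere 0 1 - \<delta> ` X \<subseteq> cball 0 1" by auto
    ultimately show ?thesis
      using inj_on_image_set_diff[OF \<phi>(3), of "sphere 0 1" "\<delta> ` X"] \<phi>(4) by simp
  qed
  \<comment> \<open>the end points of \<open>s\<close> lie in \<open>b\<close>, being limits of boundary points of the cell off \<open>s\<close>\<close>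
  have "\<phi> ` (sphere 0 1 - \<delta> ` {0..1}) \<subseteq> b"
    using image_diff[of "{0..1}"] bdi \<gamma>(3) by auto
  then have "Y closure_of (\<phi> ` (sphere 0 1 - \<delta> ` {0..1})) \<subseteq> b"
    using cl by (simp add: b_def closure_of_minimal closedin_Int)
  moreover have "\<phi> ` (top_of_set (cball 0 1) closure_of (sphere 0 1 - \<delta> ` {0..1})) \<subseteq> Y closure_of (\<phi> ` (sphere 0 1 - \<delta> ` {0..1}))"
    by (rule continuous_map_image_closure_subset[OF \<phi>(5)])
  moreover have "{\<delta> 0, \<delta> 1} \<subseteq> top_of_set (cball 0 1) closure_of (sphere 0 1 - \<delta> ` {0..1})"
  proof -
    have "cball 0 1 \<inter> (sphere 0 1 - \<delta> ` {0..1}) = sphere 0 1 - \<delta> ` {0..1}" by auto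
    moreover have "{\<delta> 0, \<delta> 1} \<subseteq> cball 0 1" using \<delta>(3) by (auto simp: image_subset_iff)
    ultimately show ?thesis
      using circle_minus_open_arc(2)[OF \<delta>(1-3)] by (simp add: closure_of_subtopology)
  qed
  ultimately have "\<phi> ` {\<delta> 0, \<delta> 1} \<subseteq> b" by blast
  then have ends: "{\<gamma> 0, \<gamma> 1} \<subseteq> b" using \<delta>(4) by auto
  have "{0..1} = {0<..<1} \<union> {0, 1::real}" by auto
  then have s_eq: "s = \<gamma> ` {0<..<1} \<union> {\<gamma> 0, \<gamma> 1}"
    using \<gamma>(3) by (metis image_Un image_insert image_empty)
  have "b = disc_boundary Y (cell i) - \<gamma> ` {0<..<1}"
    unfolding bdi using s_eq ends open_arc by (auto simp: b_def)
  then have b_eq: "b = \<phi> ` (sphere 0 1 - \<delta> ` {0<..<1})"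
    using image_diff[of "{0<..<1}"] greaterThanLessThan_subseteq_atLeastAtMost_iff[of 0 1 0 "1::real"]
    by simp
  have "connectedin (top_of_set (cball 0 1)) (sphere 0 1 - \<delta> ` {0<..<1})"
    using circle_minus_open_arc(1)[OF \<delta>(1-3)] by (auto simp: connectedin_subtopology)
  then have conb: "connectedin Y b"
    unfolding b_eq using \<phi>(5) connectedin_continuous_map_image by blast
  have "connectedin Y (R \<union> b)"
  proof (rule connectedin_replace_arc[where s = s])
    show "closedin Y R" "closedin Y b" using cl by (auto simp: R_def b_def)
    show "closedin Y s" using cl s(1) by blast
    show "connectedin Y (s \<union> R)" using circ by (simp add: circular_def bdI)
    show "R \<inter> s \<subseteq> b" using s(1) by (auto simp: R_def b_def)
  qed (use conb ends s_eq in auto)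
  then show ?thesis
    using ends by (auto simp: circular_def bdI')
qed

text \<open>Since \<open>Y\<close> is connected, neither part is open and closed in \<open>Y\<close>, so each of them meets the
  remaining cells. Hence each contains a point of the boundary, and the boundary is separated.\<close>

lemma not_circular_separated:
  assumes Y: "connected_space Y" and I: "I = I1 \<union> I2" "I \<subseteq> C" "I1 \<noteq> {}" "I2 \<noteq> {}"
    and sep: "\<Union>(cell ` I1) \<inter> \<Union>(cell ` I2) = {}"
  shows "\<not> circular I"
proof
  assume "circular I"
  then have con: "connectedin Y (interface I)" by (simp add: circular_def)
  define R where "R = \<Union>(cell ` (C - I))"
  have bd: "interface I \<subseteq> R" "interface I \<subseteq> \<Union>(cell ` I1) \<union> \<Union>(cell ` I2)"
    and in_bd: "\<Union>(cell ` I1) \<inter> R \<subseteq> interface I" "\<Union>(cell ` I2) \<inter> R \<subseteq> interface I"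
    using I by (auto simp: interface_def R_def)
  have cl: "closedin Y (\<Union>(cell ` I1))" "closedin Y (\<Union>(cell ` I2))" "closedin Y R"
    using I closedin_cells by (auto simp: R_def)
  have impossible: False
    if cl: "closedin Y P" "closedin Y Q" "closedin Y R" and PQ: "P \<inter> Q = {}" "P \<inter> R = {}" "P \<union> Q \<union> R = topspace Y"
      and ne: "P \<noteq> {}" "Q \<noteq> {}" for P Q R
  proof -
    have "closedin Y (Q \<union> R)" using cl by blast
    moreover have "P \<inter> (Q \<union> R) = {}" "topspace Y \<subseteq> P \<union> (Q \<union> R)" "Q \<union> R \<noteq> {}" using PQ ne by auto
    ultimately show False
      using Y cl(1) ne(1) unfolding connected_space_closedin by blast
  qed
  have nonempty: "\<Union>(cell ` J) \<noteq> {}" if J: "J \<noteq> {}" "J \<subseteq> C" for J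
  proof -
    obtain j where "j \<in> J" "j \<in> C" using J by blast
    then show ?thesis using disc_nonempty[OF disc[of j]] by blast
  qed
  have ne: "\<Union>(cell ` I1) \<noteq> {}" "\<Union>(cell ` I2) \<noteq> {}"
    using nonempty[of I1] nonempty[of I2] I by blast+
  have cov: "\<Union>(cell ` I1) \<union> \<Union>(cell ` I2) \<union> R = topspace Y" "\<Union>(cell ` I2) \<union> \<Union>(cell ` I1) \<union> R = topspace Y"
    using cover I by (auto simp: R_def)
  have "\<Union>(cell ` I1) \<inter> R \<noteq> {}"
    using impossible[OF cl(1,2,3) sep _ cov(1)] ne by blast
  moreover have "\<Union>(cell ` I2) \<inter> R \<noteq> {}"
    using impossible[OF cl(2,1,3) _ _ cov(2)] sep ne by blast
  ultimately have "\<Union>(cell ` I1) \<inter> interface I \<noteq> {}" "\<Union>(cell ` I2) \<inter> interface I \<noteq> {}"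
    using in_bd by blast+
  then show False
    using connectedin_closedin[THEN iffD1, OF con] cl(1,2) bd(2) sep by blast
qed

end

section \<open>Spanning trees of a multigraph\<close>

locale multigraph =
  fixes V :: "'v set" and E :: "'e set" and inc :: "'e \<Rightarrow> 'v set"
  assumes finV: "finite V" and finE: "finite E" and neV: "V \<noteq> {}"
    and inc: "e \<in> E \<Longrightarrow> \<exists>u \<in> V. \<exists>w \<in> V. inc e = {u, w}"
begin

definition cycle :: "'v list \<Rightarrow> 'e list \<Rightarrow> bool" where
  "cycle vs es \<longleftrightarrow> es \<noteq> [] \<and> length vs = length es \<and> distinct vs \<and> distinct es \<and>
     set vs \<subseteq> V \<and> set es \<subseteq> E \<and>
     (\<forall>i < length es. inc (es ! i) = {vs ! i, vs ! (Suc i mod length es)})"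

definition forest :: "'e set \<Rightarrow> bool" where
  "forest A \<longleftrightarrow> A \<subseteq> E \<and> \<not> (\<exists>vs es. cycle vs es \<and> set es \<subseteq> A)"

definition crosses :: "'v set \<Rightarrow> 'e \<Rightarrow> bool" where
  "crosses W e \<longleftrightarrow> inc e \<inter> W \<noteq> {} \<and> inc e - W \<noteq> {}"

text \<open>Connectedness of \<open>(V, A)\<close>, expressed by cuts.\<close>

definition spans :: "'e set \<Rightarrow> bool" where
  "spans A \<longleftrightarrow> (\<forall>W \<subset> V. W \<noteq> {} \<longrightarrow> (\<exists>e \<in> A. crosses W e))"

text \<open>Trees grow by leaves, so that statements about them can be proved by attaching one edge and one
  vertex at a time.\<close>

inductive tree :: "'v set \<Rightarrow> 'e set \<Rightarrow> bool" where
  tree_single: "v \<in> V \<Longrightarrow> tree {v} {}"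
| tree_leaf: "tree W T \<Longrightarrow> e \<in> E \<Longrightarrow> inc e = {w, v} \<Longrightarrow> w \<in> W \<Longrightarrow> v \<in> V - W \<Longrightarrow>
     tree (insert v W) (insert e T)"

lemma tree_subset: "tree W T \<Longrightarrow> W \<subseteq> V \<and> W \<noteq> {} \<and> T \<subseteq> E \<and> (\<forall>e \<in> T. inc e \<subseteq> W)"
  by (induction rule: tree.induct) auto

lemma tree_card: "tree W T \<Longrightarrow> Suc (card T) = card W"
proof (induction rule: tree.induct)
  case (tree_leaf W T e w v)
  then have "e \<notin> T" "finite T" "finite W" "v \<notin> W"
    using tree_subset[OF tree_leaf.hyps(1)] finV finE by (auto intro: finite_subset)
  then show ?case using tree_leaf.IH by simp
qed auto

text \<open>A tree inside \<open>A\<close> with as many vertices as possible spans, since an edge of \<open>A\<close> that leaves it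
  could be added.\<close>

lemma spanning_tree_exists:
  assumes A: "spans A" "A \<subseteq> E"
  shows "\<exists>T. T \<subseteq> A \<and> tree V T"
proof -
  obtain v where "v \<in> V" using neV by blast
  then have "\<exists>T. tree {v} T \<and> T \<subseteq> A" using tree_single by blast
  moreover have "\<forall>W. (\<exists>T. tree W T \<and> T \<subseteq> A) \<longrightarrow> card W < Suc (card V)"
  proof (intro allI impI)
    fix W assume "\<exists>T. tree W T \<and> T \<subseteq> A"
    then obtain T where "tree W T" by blast
    then have "W \<subseteq> V" using tree_subset by simp
    then show "card W < Suc (card V)" using card_mono[OF finV] by (simp add: less_Suc_eq_le)
  qed
  ultimately obtain W where W: "\<exists>T. tree W T \<and> T \<subseteq> A"
    and max: "\<And>W'. \<exists>T. tree W' T \<and> T \<subseteq> A \<Longrightarrow> card W' \<le> card W"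
    using Lattices_Big.ex_has_greatest_nat[of "\<lambda>W. \<exists>T. tree W T \<and> T \<subseteq> A" "{v}" card "Suc (card V)"]
    by blast
  then obtain T where T: "tree W T" "T \<subseteq> A" by blast
  have "W = V"
  proof (rule ccontr)
    assume "W \<noteq> V"
    then have "W \<subset> V" "W \<noteq> {}" using tree_subset[OF T(1)] by auto
    then have "\<exists>e \<in> A. crosses W e" using A(1) by (simp add: spans_def)
    then obtain e where e: "e \<in> A" "crosses W e" by blast
    have "e \<in> E" using e A(2) by blast
    obtain u u' where uu: "u \<in> V" "u' \<in> V" "inc e = {u, u'}" using inc[OF \<open>e \<in> E\<close>] by blast
    then have "u \<in> W \<and> u' \<notin> W \<or> u' \<in> W \<and> u \<notin> W"
      using e(2) by (auto simp: crosses_def)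
    then obtain w v where wv: "inc e = {w, v}" "w \<in> W" "v \<in> V - W"
      using uu insert_commute[of u u' "{}"] by (metis DiffI)
    have "tree (insert v W) (insert e T)"
      by (rule tree_leaf[OF T(1) \<open>e \<in> E\<close> wv])
    moreover have "insert e T \<subseteq> A" using T(2) e(1) by simp
    ultimately have "card (insert v W) \<le> card W" by (intro max) blast
    moreover have "finite W" using tree_subset[OF T(1)] finV by (auto intro: finite_subset)
    ultimately show False using wv(3) by simp
  qed
  with T show ?thesis by blast
qed

text \<open>A cycle through the newest edge would pass through its leaf \<open>v\<close>, and would need two edges there.\<close>

lemma tree_forest: "tree W T \<Longrightarrow> forest T"
proof (induction rule: tree.induct)
  case (tree_single v)
  then show ?case by (auto simp: forest_def cycle_def)
next
  case (tree_leaf W T e w v)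
  have "False" if c: "cycle vs es" and es: "set es \<subseteq> insert e T" for vs es
  proof -
    let ?n = "length es"
    have n: "length vs = ?n" "0 < ?n" "distinct es" "distinct vs"
      "\<And>i. i < ?n \<Longrightarrow> inc (es ! i) = {vs ! i, vs ! (Suc i mod ?n)}"
      using c by (auto simp: cycle_def)
    have "\<not> set es \<subseteq> T" using tree_leaf.IH c by (auto simp: forest_def)
    then have "e \<in> set es" using es by blast
    then obtain i where i: "i < ?n" "es ! i = e" by (metis in_set_conv_nth)
    have wv: "w \<noteq> v" using tree_leaf.hyps by auto
    have only: "j = i" if "j < ?n" "v \<in> inc (es ! j)" for j
    proof -
      have "es ! j \<in> insert e T" using es that nth_mem by blast
      moreover have "es ! j \<notin> T"
        using that tree_subset[OF tree_leaf.hyps(1)] tree_leaf.hyps(5) by blast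
      ultimately show ?thesis using i n(3) that(1) by (metis insertE nth_eq_iff_index_eq)
    qed
    have inci: "{w, v} = {vs ! i, vs ! (Suc i mod ?n)}" using n(5)[OF i(1)] i tree_leaf.hyps by simp
    \<comment> \<open>the edges of the cycle before and after its visit to \<open>v\<close>, at positions \<open>k\<close> and \<open>j\<close>, can only
      be \<open>e\<close>, so the cycle is a loop\<close>
    obtain j where j: "j < ?n" "vs ! j = v"
      using inci i(1) n(2) by (metis doubleton_eq_iff mod_less_divisor)
    define k where "k = (if j = 0 then ?n - 1 else j - 1)"
    have k: "k < ?n" "Suc k mod ?n = j" using j(1) by (auto simp: k_def)
    have "j = i" using only[OF j(1)] n(5)[OF j(1)] j(2) by simp
    moreover have "k = i" using only[OF k(1)] n(5)[OF k(1)] j(2) k(2) by simp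
    ultimately have "vs ! i = v" "vs ! (Suc i mod ?n) = v" using j k by auto
    then show False using inci wv by auto
  qed
  then show ?case
    using tree_leaf.hyps(2) tree_leaf.IH unfolding forest_def by blast
qed

definition vertex_path :: "'v list \<Rightarrow> 'e list \<Rightarrow> bool" where
  "vertex_path vs es \<longleftrightarrow> length vs = Suc (length es) \<and> distinct vs \<and> distinct es \<and>
     (\<forall>i < length es. inc (es ! i) = {vs ! i, vs ! Suc i})"

lemma vertex_path_single: "vertex_path [u] []"
  by (simp add: vertex_path_def)

lemma vertex_path_rev:
  assumes "vertex_path vs es" shows "vertex_path (rev vs) (rev es)"
proof -
  have "inc (rev es ! i) = {rev vs ! i, rev vs ! Suc i}" if "i < length es" for i
  proof -
    have "rev es ! i = es ! (length es - Suc i)" "rev vs ! i = vs ! (Suc (length es) - Suc i)"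
      "rev vs ! Suc i = vs ! (Suc (length es) - Suc (Suc i))"
      using that assms by (auto simp: rev_nth vertex_path_def)
    moreover have "inc (es ! (length es - Suc i)) = {vs ! (length es - Suc i), vs ! Suc (length es - Suc i)}"
      using assms that by (simp add: vertex_path_def)
    ultimately show ?thesis using that by (auto simp: Suc_diff_Suc)
  qed
  then show ?thesis using assms by (simp add: vertex_path_def)
qed

lemma vertex_path_Cons:
  assumes "vertex_path vs es" "v \<notin> set vs" "e \<notin> set es" "inc e = {v, hd vs}"
  shows "vertex_path (v # vs) (e # es)"
proof -
  have "hd vs = vs ! 0" using assms(1) by (cases vs) (auto simp: vertex_path_def)
  then show ?thesis using assms by (auto simp: vertex_path_def nth_Cons split: nat.split)
qed

lemma tree_vertex_path:
  "tree W T \<Longrightarrow> x \<in> W \<Longrightarrow> y \<in> W \<Longrightarrow>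
     \<exists>vs es. vertex_path vs es \<and> set vs \<subseteq> W \<and> set es \<subseteq> T \<and> hd vs = x \<and> last vs = y"
proof (induction arbitrary: x y rule: tree.induct)
  case (tree_single v)
  then show ?case using vertex_path_single by (intro exI[of _ "[v]"] exI[of _ "[]"]) auto
next
  case (tree_leaf W T e w v)
  have eT: "e \<notin> T" "v \<notin> W" using tree_subset[OF tree_leaf.hyps(1)] tree_leaf.hyps by auto
  have leaf: "\<exists>vs es. vertex_path vs es \<and> set vs \<subseteq> insert v W \<and> set es \<subseteq> insert e T \<and> hd vs = v \<and> last vs = y"
    if y: "y \<in> W" for y
  proof -
    obtain vs es where p: "vertex_path vs es" "set vs \<subseteq> W" "set es \<subseteq> T" "hd vs = w" "last vs = y"
      using tree_leaf.IH[OF tree_leaf.hyps(4) y] by blast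
    then have "vertex_path (v # vs) (e # es)"
      using eT tree_leaf.hyps(3) by (intro vertex_path_Cons) (auto simp: insert_commute)
    moreover have "vs \<noteq> []" using p(1) by (auto simp: vertex_path_def)
    ultimately show ?thesis
      using p by (intro exI[of _ "v # vs"] exI[of _ "e # es"]) auto
  qed
  consider "x = v" "y = v" | "x = v" "y \<in> W" | "x \<in> W" "y = v" | "x \<in> W" "y \<in> W"
    using tree_leaf.prems by blast
  then show ?case
  proof cases
    case 1
    then show ?thesis using vertex_path_single by (intro exI[of _ "[v]"] exI[of _ "[]"]) auto
  next
    case 2
    then show ?thesis using leaf[of y] by blast
  next
    case 3
    then obtain vs es where p: "vertex_path vs es" "set vs \<subseteq> insert v W" "set es \<subseteq> insert e T" "hd vs = v" "last vs = x"
      using leaf[of x] by blast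
    moreover have "vs \<noteq> []" using p(1) by (auto simp: vertex_path_def)
    ultimately show ?thesis
      using 3 vertex_path_rev[OF p(1)] by (intro exI[of _ "rev vs"] exI[of _ "rev es"]) (auto simp: hd_rev last_rev)
  next
    case 4
    then show ?thesis using tree_leaf.IH[of x y] by blast
  qed
qed

lemma vertex_path_close:
  assumes p: "vertex_path vs es" "set vs \<subseteq> V" "set es \<subseteq> E" and e: "e \<in> E - set es" "inc e = {last vs, hd vs}"
  shows "cycle vs (es @ [e])"
proof -
  have "vs \<noteq> []" using p by (auto simp: vertex_path_def)
  then have "last vs = vs ! length es" "hd vs = vs ! 0"
    using p by (auto simp: vertex_path_def last_conv_nth hd_conv_nth)
  moreover have "inc ((es @ [e]) ! i) = {vs ! i, vs ! (Suc i mod Suc (length es))}" if "i < Suc (length es)" for i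
    using that p e(2) calculation by (cases "i = length es") (auto simp: vertex_path_def nth_append)
  ultimately show ?thesis
    using p e by (auto simp: cycle_def vertex_path_def)
qed

text \<open>A further edge closes a cycle with the path in the tree between its ends.\<close>

lemma spanning_tree_maximal:
  assumes T: "tree V T" and A: "forest A" "T \<subseteq> A"
  shows "A = T"
proof (rule ccontr)
  assume "A \<noteq> T"
  then obtain e where e: "e \<in> A" "e \<notin> T" "e \<in> E" using A by (auto simp: forest_def)
  then obtain u w where uw: "u \<in> V" "w \<in> V" "inc e = {u, w}" using inc by blast
  then obtain vs es where p: "vertex_path vs es" "set vs \<subseteq> V" "set es \<subseteq> T" "hd vs = w" "last vs = u"
    using tree_vertex_path[OF T, of w u] by blast
  have "cycle vs (es @ [e])"
    using p e uw tree_subset[OF T] by (intro vertex_path_close) auto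
  then show False using A p(3) e by (fastforce simp: forest_def)
qed

text \<open>Otherwise, running along the cycle from one end of \<open>e\<close> to its other end would never change sides.\<close>

lemma cycle_crosses_again:
  assumes c: "cycle vs es" and e: "e \<in> set es" "crosses W e"
  obtains e' where "e' \<in> set es" "e' \<noteq> e" "crosses W e'"
proof -
  have False if no: "\<And>e'. e' \<in> set es \<Longrightarrow> e' \<noteq> e \<Longrightarrow> \<not> crosses W e'"
  proof -
    let ?n = "length es"
    have n: "0 < ?n" "distinct es" "\<And>i. i < ?n \<Longrightarrow> inc (es ! i) = {vs ! i, vs ! (Suc i mod ?n)}"
      using c by (auto simp: cycle_def)
    obtain i where i: "i < ?n" "es ! i = e" using e by (metis in_set_conv_nth)
    have "vs ! ((Suc i + k) mod ?n) \<in> W \<longleftrightarrow> vs ! (Suc i mod ?n) \<in> W" if "k < ?n" for k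
      using that
    proof (induction k)
      case (Suc k)
      define j where "j = (Suc i + k) mod ?n"
      have j: "j < ?n" "Suc j mod ?n = (Suc i + Suc k) mod ?n"
        using n(1) by (auto simp: j_def mod_Suc_eq)
      have "j \<noteq> i"
      proof
        assume "j = i"
        then have "(i + Suc k) mod ?n = i mod ?n" using i(1) by (simp add: j_def)
        then have "?n dvd Suc k" by (subst (asm) mod_eq_dvd_iff_nat) auto
        then show False using Suc.prems by (simp add: nat_dvd_not_less)
      qed
      then have "es ! j \<noteq> e" using i j(1) n(2) nth_eq_iff_index_eq by blast
      then have "\<not> crosses W (es ! j)" using no nth_mem[OF j(1)] by blast
      then have "vs ! j \<in> W \<longleftrightarrow> vs ! (Suc j mod ?n) \<in> W"
        using n(3)[OF j(1)] by (auto simp: crosses_def)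
      then show ?case using Suc j by (simp add: j_def)
    qed simp
    from this[of "?n - 1"] have "vs ! i \<in> W \<longleftrightarrow> vs ! (Suc i mod ?n) \<in> W"
      using n(1) i(1) by simp
    then show False
      using e(2) n(3)[OF i(1)] i(2) by (auto simp: crosses_def)
  qed
  with that show thesis by blast
qed

text \<open>If no edge of \<open>A\<close> crosses some cut, then an edge of \<open>E\<close> that does can be added without creating
  a cycle, because cycles cross cuts more than once.\<close>

lemma maximal_forest_spans:
  assumes E: "spans E" and A: "forest A" "\<And>A'. forest A' \<Longrightarrow> A \<subseteq> A' \<Longrightarrow> A' = A"
  shows "spans A"
proof (rule ccontr)
  assume "\<not> spans A"
  then obtain W where W: "W \<subset> V" "W \<noteq> {}" "\<And>e. e \<in> A \<Longrightarrow> \<not> crosses W e"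
    unfolding spans_def by blast
  then obtain e where e: "e \<in> E" "crosses W e" using E unfolding spans_def by blast
  have "forest (insert e A)"
    unfolding forest_def
  proof (intro conjI notI)
    assume "\<exists>vs es. cycle vs es \<and> set es \<subseteq> insert e A"
    then obtain vs es where c: "cycle vs es" "set es \<subseteq> insert e A" by blast
    then have "\<not> set es \<subseteq> A" using A(1) by (auto simp: forest_def)
    then have "e \<in> set es" using c(2) by blast
    then obtain e' where "e' \<in> set es" "e' \<noteq> e" "crosses W e'"
      using cycle_crosses_again[OF c(1) _ e(2)] by blast
    then show False using c(2) W(3) by blast
  qed (use A(1) e in \<open>auto simp: forest_def\<close>)
  then have "insert e A = A" using A(2) by blast
  then show False using W(3) e by blast
qed

lemma maximal_forest_iff_spanning_tree:
  assumes "spans E"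
  shows "forest A \<and> (\<forall>A'. forest A' \<and> A \<subseteq> A' \<longrightarrow> A' = A) \<longleftrightarrow> tree V A"
proof
  assume A: "forest A \<and> (\<forall>A'. forest A' \<and> A \<subseteq> A' \<longrightarrow> A' = A)"
  then have "spans A" using maximal_forest_spans[OF assms, of A] by blast
  then obtain T where T: "T \<subseteq> A" "tree V T"
    using spanning_tree_exists[of A] A unfolding forest_def by blast
  then have "A = T" using spanning_tree_maximal A by blast
  then show "tree V A" using T by simp
qed (use tree_forest spanning_tree_maximal in blast)

text \<open>The property \<open>P\<close> stands for feasibility: enough to connect the graph, and implied by being a
  spanning tree.\<close>

lemma smallest_spanning_sets:
  assumes spans: "\<And>A. P A \<Longrightarrow> A \<subseteq> E \<and> spans A" and tree: "\<And>T. tree V T \<Longrightarrow> P T"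
  shows "P A \<and> (\<forall>B. P B \<longrightarrow> card A \<le> card B) \<longleftrightarrow> tree V A"
proof
  assume A: "P A \<and> (\<forall>B. P B \<longrightarrow> card A \<le> card B)"
  then obtain T where T: "T \<subseteq> A" "tree V T" using spans[of A] spanning_tree_exists[of A] by blast
  then have "card A \<le> card T" using A tree by blast
  moreover have "finite A" using A spans finE finite_subset by blast
  ultimately have "T = A" using T(1) by (intro card_seteq)
  then show "tree V A" using T(2) by simp
next
  assume A: "tree V A"
  have "card A \<le> card B" if B: "P B" for B
  proof -
    obtain T where T: "T \<subseteq> B" "tree V T" using spans[OF B] spanning_tree_exists[of B] by blast
    have "card A = card T" using tree_card[OF A] tree_card[OF T(2)] by simp
    also have "\<dots> \<le> card B" using spans[OF B] finE T(1) by (meson card_mono finite_subset)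
    finally show ?thesis .
  qed
  then show "P A \<and> (\<forall>B. P B \<longrightarrow> card A \<le> card B)" using tree A by blast
qed

end

section \<open>Vertices, edges and faces\<close>

text \<open>A closed surface made of vertices, edges and faces, seen from the side of the vertices. The dual
  point of view exchanges \<open>V\<close> and \<open>F\<close>; vertices are indexed so that the same locale serves both for
  the vertices of \<open>G\<close>, which live on another surface, and for the caps.\<close>

locale ribbon_decomposition =
  fixes Y :: "'q topology" and V :: "'v set" and dv :: "'v \<Rightarrow> 'q set"
    and E :: "'e set" and de :: "'e \<Rightarrow> 'q set" and F :: "'f set" and df :: "'f \<Rightarrow> 'q set"
  assumes decomposition: "cell_decomposition Y (V <+> E <+> F) (case_sum dv (case_sum de df))"
    and connected: "connected_space Y" and nonempty: "V \<noteq> {}"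
    and disjoint_vertices: "v \<in> V \<Longrightarrow> w \<in> V \<Longrightarrow> v \<noteq> w \<Longrightarrow> dv v \<inter> dv w = {}"
    and disjoint_edges: "e \<in> E \<Longrightarrow> e' \<in> E \<Longrightarrow> e \<noteq> e' \<Longrightarrow> de e \<inter> de e' = {}"
    and edge_ends: "e \<in> E \<Longrightarrow> \<exists>s t. \<exists>u \<in> V. \<exists>w \<in> V. is_segment Y s \<and> is_segment Y t \<and>
       de e \<inter> \<Union>(dv ` V) = s \<union> t \<and> s \<subseteq> dv u \<and> t \<subseteq> dv w"
begin

sublocale cell_decomposition Y "V <+> E <+> F" "case_sum dv (case_sum de df)"
  by (rule decomposition)

definition inc :: "'e \<Rightarrow> 'v set" where
  "inc e = {v \<in> V. dv v \<inter> de e \<noteq> {}}"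

lemma edge_endsE:
  assumes "e \<in> E"
  obtains s t u w where "u \<in> V" "w \<in> V" "is_segment Y s" "is_segment Y t"
    "de e \<inter> \<Union>(dv ` V) = s \<union> t" "s \<subseteq> dv u" "t \<subseteq> dv w" "inc e = {u, w}"
proof -
  obtain s t u w where *: "u \<in> V" "w \<in> V" "is_segment Y s" "is_segment Y t"
    "de e \<inter> \<Union>(dv ` V) = s \<union> t" "s \<subseteq> dv u" "t \<subseteq> dv w"
    using edge_ends[OF assms] by blast
  have "s \<noteq> {}" "t \<noteq> {}" using is_segment_nonempty * by auto
  moreover have "s \<subseteq> de e" "t \<subseteq> de e" using *(5) by blast+
  ultimately have "u \<in> inc e" "w \<in> inc e" using *(1,2,6,7) unfolding inc_def by blast+
  moreover have "v = u \<or> v = w" if v: "v \<in> inc e" for v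
  proof -
    obtain x where x: "x \<in> dv v" "x \<in> de e" "v \<in> V" using v unfolding inc_def by blast
    then have "x \<in> de e \<inter> \<Union>(dv ` V)" by blast
    then have "x \<in> s \<union> t" by (simp only: *(5))
    then have "x \<in> dv u \<or> x \<in> dv w" using *(6,7) by blast
    then show ?thesis
      using disjoint_vertices[OF x(3) *(1)] disjoint_vertices[OF x(3) *(2)] x(1) by blast
  qed
  ultimately have "inc e = {u, w}" by auto
  with * show thesis by (rule that)
qed

sublocale multigraph V E inc
proof
  show "finite V" "finite E" using finite_cells by (auto simp: finite_Plus_iff)
  show "\<exists>u\<in>V. \<exists>w\<in>V. inc e = {u, w}" if "e \<in> E" for e
    using edge_endsE[OF that] by metis
qed (rule nonempty)

definition ribbons :: "'v set \<Rightarrow> 'e set \<Rightarrow> 'q set" where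
  "ribbons W A = \<Union>(dv ` W) \<union> \<Union>(de ` A)"

abbreviation subcells :: "'v set \<Rightarrow> 'e set \<Rightarrow> ('v + 'e + 'f) set" where
  "subcells W A \<equiv> W <+> A <+> {}"

lemma cells_ribbons: "\<Union>(case_sum dv (case_sum de df) ` subcells W A) = ribbons W A"
  by (auto simp: ribbons_def Plus_def)

lemma cells_complement:
  "\<Union>(case_sum dv (case_sum de df) ` ((V <+> E <+> F) - subcells V A)) = \<Union>(de ` (E - A)) \<union> \<Union>(df ` F)"
proof -
  have "(V <+> E <+> F) - subcells V A = {} <+> (E - A) <+> F" by (auto simp: Plus_def image_iff)
  then show ?thesis by (auto simp: Plus_def image_iff)
qed

lemma interface_ribbons:
  "interface (subcells V A) = ribbons V A \<inter> (\<Union>(df ` F) \<union> \<Union>(de ` (E - A)))"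
  unfolding interface_def cells_ribbons cells_complement by blast

text \<open>The new edge \<open>e\<close> meets the tree in one of its two segments, and after that the new vertex
  meets the tree with \<open>e\<close> in the other one. So both are attached along a single segment.\<close>

lemma tree_circular: "tree W T \<Longrightarrow> circular (subcells W T)"
proof (induction rule: tree.induct)
  case (tree_single v)
  have "subcells {v} {} = {Inl v}" by (auto simp: Plus_def image_iff)
  then show ?case using circular_single[of "Inl v"] tree_single by auto
next
  case (tree_leaf W T e w v)
  have WT: "W \<subseteq> V" "T \<subseteq> E" and inc_T: "\<And>e'. e' \<in> T \<Longrightarrow> inc e' \<subseteq> W"
    using tree_subset[OF tree_leaf.hyps(1)] by auto
  have e: "e \<in> E" "e \<notin> T" using inc_T[of e] tree_leaf.hyps by auto
  have wv: "w \<in> V" "v \<in> V" "w \<noteq> v" "v \<notin> W" using tree_leaf.hyps WT by auto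
  obtain s t where st: "is_segment Y s" "is_segment Y t" "de e \<inter> \<Union>(dv ` V) = s \<union> t"
    "s \<subseteq> dv w" "t \<subseteq> dv v"
  proof -
    obtain s t u u' where "is_segment Y s" "is_segment Y t" "de e \<inter> \<Union>(dv ` V) = s \<union> t"
      "s \<subseteq> dv u" "t \<subseteq> dv u'" "inc e = {u, u'}"
      using edge_endsE[OF e(1)] by metis
    moreover from this have "u = w \<and> u' = v \<or> u = v \<and> u' = w"
      using tree_leaf.hyps(3) by (auto simp: doubleton_eq_iff)
    ultimately show thesis
      using that[of s t] that[of t s] by (metis Un_commute)
  qed
  have disj: "dv v \<inter> dv w' = {}" if "w' \<in> W" for w'
    using disjoint_vertices[of v w'] that WT wv by blast
  have disj_e: "de e \<inter> de e' = {}" if "e' \<in> T" for e'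
    using disjoint_edges[of e e'] that WT e by blast
  have disj_v: "dv v \<inter> de e' = {}" if "e' \<in> T" for e'
    using inc_T[OF that] wv by (auto simp: inc_def)
  let ?I = "subcells W T"
  have I: "?I \<subseteq> V <+> E <+> F" using WT by auto
  have "circular (insert (Inr (Inl e)) ?I)"
  proof (rule circular_attach[OF I, where j = "Inl w" and s = s])
    have "de e \<inter> ribbons W T = de e \<inter> \<Union>(dv ` W)"
      using disj_e unfolding ribbons_def by blast
    also have "\<dots> = s"
    proof
      show "de e \<inter> \<Union>(dv ` W) \<subseteq> s" using st WT disj by blast
      show "s \<subseteq> de e \<inter> \<Union>(dv ` W)" using st tree_leaf.hyps(4) by blast
    qed
    finally show "case_sum dv (case_sum de df) (Inr (Inl e)) \<inter> \<Union>(case_sum dv (case_sum de df) ` ?I) = s"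
      by (simp add: cells_ribbons)
  qed (use e st tree_leaf in auto)
  then have "circular (insert (Inl v) (insert (Inr (Inl e)) ?I))"
  proof (rule circular_attach[rotated -1, where j = "Inr (Inl e)" and s = t])
    have eq: "insert (Inr (Inl e)) ?I = subcells W (insert e T)" by (auto simp: Plus_def image_iff)
    have "dv v \<inter> ribbons W (insert e T) = dv v \<inter> de e"
      using disj disj_v unfolding ribbons_def by blast
    also have "\<dots> = t"
    proof
      show "dv v \<inter> de e \<subseteq> t" using st wv disj tree_leaf.hyps(4) by blast
      show "t \<subseteq> dv v \<inter> de e" using st by blast
    qed
    finally show "case_sum dv (case_sum de df) (Inl v) \<inter> \<Union>(case_sum dv (case_sum de df) ` insert (Inr (Inl e)) ?I) = t"
      by (simp add: eq cells_ribbons)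
  qed (use I e wv st in auto)
  moreover have "insert (Inl v) (insert (Inr (Inl e)) ?I) = subcells (insert v W) (insert e T)"
    by (auto simp: Plus_def image_iff)
  ultimately show ?case by simp
qed

text \<open>The two parts consist of the vertices on either side of an uncrossed cut, each together with its
  incident edges.\<close>

lemma not_spans_separation:
  assumes A: "A \<subseteq> E" and "\<not> spans A"
  obtains W B where "W \<subset> V" "W \<noteq> {}" "B \<subseteq> A" "ribbons W B \<inter> ribbons (V - W) (A - B) = {}"
proof -
  obtain W where W: "W \<subset> V" "W \<noteq> {}" and "\<not> (\<exists>e\<in>A. crosses W e)"
    using assms(2) unfolding spans_def by metis
  then have no: "inc e \<inter> W = {} \<or> inc e \<subseteq> W" if "e \<in> A" for e
    using that by (auto simp: crosses_def)
  define B where "B = {e \<in> A. inc e \<subseteq> W}"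
  have A2: "inc e \<inter> W = {}" if "e \<in> A - B" for e using no that by (auto simp: B_def)
  have "dv w \<inter> dv v = {}" if "w \<in> W" "v \<in> V - W" for w v
    using disjoint_vertices[of w v] that W by blast
  moreover have "dv w \<inter> de e = {}" if "w \<in> W" "e \<in> A - B" for w e
    using A2[OF that(2)] that W(1) by (auto simp: inc_def)
  moreover have "de e \<inter> dv v = {}" if "v \<in> V - W" "e \<in> B" for v e
    using that by (auto simp: inc_def B_def)
  moreover have "de e \<inter> de e' = {}" if "e \<in> B" "e' \<in> A - B" for e e'
    using disjoint_edges[of e e'] that A by (auto simp: B_def)
  ultimately have "ribbons W B \<inter> ribbons (V - W) (A - B) = {}"
    unfolding ribbons_def Int_Un_distrib Int_Un_distrib2 Un_empty Int_UN_distrib2 SUP_bot_conv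
    by simp
  moreover have "B \<subseteq> A" by (auto simp: B_def)
  ultimately show thesis using W by (intro that)
qed

lemma circular_spans:
  assumes A: "A \<subseteq> E" and circ: "circular (subcells V A)"
  shows "spans A"
proof (rule ccontr)
  assume "\<not> spans A"
  then obtain W B where W: "W \<subset> V" "W \<noteq> {}" "B \<subseteq> A"
    and sep: "ribbons W B \<inter> ribbons (V - W) (A - B) = {}"
    using not_spans_separation[OF A] by metis
  have "subcells V A = subcells W B \<union> subcells (V - W) (A - B)"
    using W by (auto simp: Plus_def image_iff)
  moreover have "subcells W B \<noteq> {}" "subcells (V - W) (A - B) \<noteq> {}" "subcells V A \<subseteq> V <+> E <+> F"
    using W A by auto
  ultimately show False
    using not_circular_separated[OF connected, of "subcells V A" "subcells W B" "subcells (V - W) (A - B)"] circ sep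
    by (simp add: cells_ribbons)
qed

lemma connected_spans:
  assumes A: "A \<subseteq> E" and con: "connectedin Y (ribbons V A)"
  shows "spans A"
proof (rule ccontr)
  assume "\<not> spans A"
  then obtain W B where W: "W \<subset> V" "W \<noteq> {}" "B \<subseteq> A"
    and sep: "ribbons W B \<inter> ribbons (V - W) (A - B) = {}"
    using not_spans_separation[OF A] by metis
  have closed: "closedin Y (ribbons W' A')" if "W' \<subseteq> V" "A' \<subseteq> E" for W' A'
    using closedin_cells[of "subcells W' A'"] that by (auto simp: cells_ribbons)
  have ne: "ribbons W' A' \<noteq> {}" if "W' \<subseteq> V" "W' \<noteq> {}" for W' A'
  proof -
    obtain w where "w \<in> W'" "w \<in> V" using \<open>W' \<subseteq> V\<close> \<open>W' \<noteq> {}\<close> by blast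
    then show ?thesis using disc_nonempty[OF disc[of "Inl w"]] by (auto simp: ribbons_def)
  qed
  have "ribbons V A = ribbons W B \<union> ribbons (V - W) (A - B)"
    using W unfolding ribbons_def by blast
  moreover have "closedin Y (ribbons W B)" "closedin Y (ribbons (V - W) (A - B))"
    using W A by (auto intro!: closed)
  moreover have "ribbons W B \<noteq> {}" "ribbons (V - W) (A - B) \<noteq> {}"
    using ne[of W B] ne[of "V - W" "A - B"] W by blast+
  ultimately show False
    using connectedin_closedin[THEN iffD1, OF con] sep by blast
qed

lemma spans_mono: "spans A \<Longrightarrow> A \<subseteq> B \<Longrightarrow> spans B"
  unfolding spans_def by blast

lemma smallest_circular_iff_tree:
  "A \<subseteq> E \<and> circular (subcells V A) \<and> (\<forall>B. B \<subseteq> E \<and> circular (subcells V B) \<longrightarrow> card A \<le> card B) \<longleftrightarrow> tree V A"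
proof -
  have "A \<subseteq> E \<and> spans A" if "A \<subseteq> E \<and> circular (subcells V A)" for A
    using circular_spans that by simp
  moreover have "T \<subseteq> E \<and> circular (subcells V T)" if "tree V T" for T
    using tree_circular[OF that] tree_subset[OF that] by simp
  ultimately show ?thesis
    using smallest_spanning_sets[of "\<lambda>A. A \<subseteq> E \<and> circular (subcells V A)" A]
    by (simp add: conj_assoc)
qed

end

section \<open>Ribbon graphs in the capped surface\<close>

lemma card_boundary_components_subtopology:
  "card (boundary_components (subtopology Y K)) = 1 \<longleftrightarrow>
     connectedin Y (surface_boundary (subtopology Y K)) \<and> surface_boundary (subtopology Y K) \<noteq> {}"
proof -
  have "surface_boundary (subtopology Y K) \<subseteq> K" by (auto simp: surface_boundary_def)
  then show ?thesis
    unfolding card_boundary_components_eq_1 connectedin_subtopology by blast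
qed

lemma card_boundary_components_homeomorphic:
  assumes f: "homeomorphic_map X Z f"
  shows "card (boundary_components X) = 1 \<longleftrightarrow> card (boundary_components Z) = 1"
proof -
  have "surface_boundary X \<subseteq> topspace X" by (auto simp: surface_boundary_def)
  then show ?thesis
    unfolding card_boundary_components_eq_1 surface_boundary_homeomorphic[OF f]
    using homeomorphic_map_connectedness[OF f] by simp
qed

lemma ribbon_graph_discs:
  assumes "ribbon_graph G"
  shows "Hausdorff_space (surf G)" "finite (verts G)" "finite (edges G)"
    "v \<in> verts G \<Longrightarrow> is_disc (surf G) v" "e \<in> edges G \<Longrightarrow> is_disc (surf G) (edge_disc G e)"
    "topspace (surf G) = \<Union>(verts G) \<union> \<Union>(edge_disc G ` edges G)"
    "v \<in> verts G \<Longrightarrow> w \<in> verts G \<Longrightarrow> v \<noteq> w \<Longrightarrow> v \<inter> w = {}"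
    "e \<in> edges G \<Longrightarrow> e' \<in> edges G \<Longrightarrow> e \<noteq> e' \<Longrightarrow> edge_disc G e \<inter> edge_disc G e' = {}"
proof -
  have G: "surface (surf G)" "finite (verts G)" "finite (edges G)"
    "\<forall>v \<in> verts G. is_disc (surf G) v" "\<forall>e \<in> edges G. is_disc (surf G) (edge_disc G e)"
    "disjoint (verts G)" "disjoint_family_on (edge_disc G) (edges G)"
    "topspace (surf G) = \<Union>(verts G) \<union> \<Union>(edge_disc G ` edges G)"
    using assms unfolding ribbon_graph_def by simp_all
  then show "Hausdorff_space (surf G)" by (simp add: surface_def)
  show "v \<in> verts G \<Longrightarrow> w \<in> verts G \<Longrightarrow> v \<noteq> w \<Longrightarrow> v \<inter> w = {}"
    using G(6) by (simp add: disjoint_def)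
  show "e \<in> edges G \<Longrightarrow> e' \<in> edges G \<Longrightarrow> e \<noteq> e' \<Longrightarrow> edge_disc G e \<inter> edge_disc G e' = {}"
    using G(7) by (simp add: disjoint_family_on_def)
  show "finite (verts G)" "finite (edges G)" "topspace (surf G) = \<Union>(verts G) \<union> \<Union>(edge_disc G ` edges G)"
    by fact+
  show "v \<in> verts G \<Longrightarrow> is_disc (surf G) v" "e \<in> edges G \<Longrightarrow> is_disc (surf G) (edge_disc G e)"
    using G(4,5) by auto
qed

text \<open>A point of an edge that lies in some vertex belongs to one of the segments. This segment lies on the
  boundary of an edge, which must be the given one since distinct edges are disjoint.\<close>

lemma ribbon_graph_attachment:
  assumes G: "ribbon_graph G" and e: "e \<in> edges G"
  shows "v \<in> verts G \<Longrightarrow> v \<inter> edge_disc G e \<subseteq> disc_boundary (surf G) (edge_disc G e)"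
    and "\<exists>s t. \<exists>u \<in> verts G. \<exists>w \<in> verts G. is_segment (surf G) s \<and> is_segment (surf G) t \<and>
       edge_disc G e \<inter> \<Union>(verts G) = s \<union> t \<and> s \<subseteq> u \<and> t \<subseteq> w"
proof -
  obtain S where S: "\<And>s. s \<in> S \<Longrightarrow> is_segment (surf G) s"
    "\<Union>(verts G) \<inter> \<Union>(edge_disc G ` edges G) = \<Union>S"
    "\<And>s. s \<in> S \<Longrightarrow> \<exists>v. v \<in> verts G \<and> s \<subseteq> disc_boundary (surf G) v"
    "\<And>s. s \<in> S \<Longrightarrow> \<exists>e. e \<in> edges G \<and> s \<subseteq> disc_boundary (surf G) (edge_disc G e)"
    "card {s \<in> S. s \<subseteq> edge_disc G e} = 2"
    using G e unfolding ribbon_graph_def by (elim conjE exE) (metis (no_types, lifting))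
  note discs = ribbon_graph_discs[OF G]
  have in_edge: "\<exists>s \<in> S. x \<in> s \<and> s \<subseteq> disc_boundary (surf G) (edge_disc G e)"
    if x: "x \<in> edge_disc G e" "x \<in> \<Union>(verts G)" for x
  proof -
    have "x \<in> \<Union>S" using x e by (subst S(2)[symmetric]) blast
    then obtain s where s: "s \<in> S" "x \<in> s" by blast
    obtain e' where e': "e' \<in> edges G" "s \<subseteq> disc_boundary (surf G) (edge_disc G e')"
      using S(4)[OF s(1)] by blast
    then have "x \<in> edge_disc G e'" using s disc_boundary_subset[OF discs(5)[OF e'(1)]] by blast
    then have "e' = e" using discs(8)[OF e'(1) e] x by blast
    with s e' show ?thesis by blast
  qed
  then show "v \<inter> edge_disc G e \<subseteq> disc_boundary (surf G) (edge_disc G e)" if "v \<in> verts G"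
    using that by blast
  obtain s t where st: "{s \<in> S. s \<subseteq> edge_disc G e} = {s, t}"
    using S(5) by (auto simp: card_2_iff)
  have edge_st: "edge_disc G e \<inter> \<Union>(verts G) = s \<union> t"
  proof
    have "\<exists>r \<in> {s \<in> S. s \<subseteq> edge_disc G e}. x \<in> r" if "x \<in> edge_disc G e \<inter> \<Union>(verts G)" for x
      using in_edge[of x] that disc_boundary_subset[OF discs(5)[OF e]] by blast
    then show "edge_disc G e \<inter> \<Union>(verts G) \<subseteq> s \<union> t" unfolding st by blast
    have "r \<subseteq> edge_disc G e \<inter> \<Union>(verts G)" if "r \<in> {s \<in> S. s \<subseteq> edge_disc G e}" for r
      using that S(2) by blast
    then show "s \<union> t \<subseteq> edge_disc G e \<inter> \<Union>(verts G)" unfolding st by simp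
  qed
  have stS: "s \<in> S" "t \<in> S" using st by blast+
  have vert: "\<exists>u \<in> verts G. r \<subseteq> u" if r: "r \<in> S" for r
  proof -
    obtain u where "u \<in> verts G" "r \<subseteq> disc_boundary (surf G) u" using S(3)[OF r] by blast
    then show ?thesis using disc_boundary_subset[OF discs(4)] by blast
  qed
  obtain u w where "u \<in> verts G" "w \<in> verts G" "s \<subseteq> u" "t \<subseteq> w"
    using vert[OF stS(1)] vert[OF stS(2)] by blast
  with edge_st show "\<exists>s t. \<exists>u \<in> verts G. \<exists>w \<in> verts G. is_segment (surf G) s \<and> is_segment (surf G) t \<and>
       edge_disc G e \<inter> \<Union>(verts G) = s \<union> t \<and> s \<subseteq> u \<and> t \<subseteq> w"
    using S(1)[OF stS(1)] S(1)[OF stS(2)]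
    by (intro exI[of _ s] exI[of _ t] bexI[of _ u] bexI[of _ w] conjI)
qed

lemma embedding_map_subtopology:
  assumes "embedding_map X Y h" "c \<subseteq> topspace X"
  shows "homeomorphic_map (subtopology X c) (subtopology Y (h ` c)) h"
proof -
  have h: "homeomorphic_map X (subtopology Y (h ` topspace X)) h"
    using assms(1) by (simp add: embedding_map_def)
  have "h ` topspace X \<subseteq> topspace Y"
    using homeomorphic_imp_surjective_map[OF h] unfolding topspace_subtopology by blast
  then have "homeomorphic_map (subtopology X c) (subtopology (subtopology Y (h ` topspace X)) (h ` c)) h"
    using assms(2) by (intro homeomorphic_map_subtopologies[OF h]) auto
  then show ?thesis
    using assms(2) by (simp add: subtopology_subtopology inf_absorb2 image_mono)
qed

lemma embedded_disc:
  assumes h: "embedding_map X Y h" and c: "is_disc X c"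
  shows "is_disc Y (h ` c)" "disc_boundary Y (h ` c) = h ` disc_boundary X c"
proof -
  have c': "c \<subseteq> topspace X" using c by (simp add: is_disc_def)
  note hom = embedding_map_subtopology[OF h c']
  have "h ` c \<subseteq> topspace Y"
    using homeomorphic_imp_surjective_map[OF hom] unfolding topspace_subtopology inf_absorb2[OF c'] by blast
  then show "is_disc Y (h ` c)"
    using c homeomorphic_space_trans[OF homeomorphic_space_sym[THEN iffD1, OF homeomorphic_map_imp_homeomorphic_space[OF hom]]]
    unfolding is_disc_def by blast
  show "disc_boundary Y (h ` c) = h ` disc_boundary X c"
    unfolding disc_boundary_def by (rule surface_boundary_homeomorphic[OF hom])
qed

lemma embedded_segment:
  assumes h: "embedding_map X Y h" and c: "is_segment X c"
  shows "is_segment Y (h ` c)"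
proof -
  have c': "c \<subseteq> topspace X" using c by (simp add: is_segment_def)
  note hom = embedding_map_subtopology[OF h c']
  have "h ` c \<subseteq> topspace Y"
    using homeomorphic_imp_surjective_map[OF hom] unfolding topspace_subtopology inf_absorb2[OF c'] by blast
  then show "is_segment Y (h ` c)"
    using c homeomorphic_space_trans[OF homeomorphic_space_sym[THEN iffD1, OF homeomorphic_map_imp_homeomorphic_space[OF hom]]]
    unfolding is_segment_def by blast
qed

text \<open>For each pair of kinds it suffices to control the boundary of one of the two discs, by
  \<open>disc_Int_subset_boundary\<close>; the other one follows. The two conclusions are the two points of view of
  a ribbon graph and its dual.\<close>

lemma cell_decompositionI:
  fixes Y :: "'q topology"
  assumes Y: "Hausdorff_space Y" "surface_boundary Y = {}"
    and fin: "finite V" "finite E" "finite F"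
    and disc: "\<And>v. v \<in> V \<Longrightarrow> is_disc Y (dv v)" "\<And>e. e \<in> E \<Longrightarrow> is_disc Y (de e)" "\<And>f. f \<in> F \<Longrightarrow> is_disc Y (df f)"
    and cover: "topspace Y = \<Union>(dv ` V) \<union> \<Union>(de ` E) \<union> \<Union>(df ` F)"
    and disj: "\<And>v w. v \<in> V \<Longrightarrow> w \<in> V \<Longrightarrow> v \<noteq> w \<Longrightarrow> dv v \<inter> dv w = {}"
      "\<And>e e'. e \<in> E \<Longrightarrow> e' \<in> E \<Longrightarrow> e \<noteq> e' \<Longrightarrow> de e \<inter> de e' = {}"
      "\<And>f g. f \<in> F \<Longrightarrow> g \<in> F \<Longrightarrow> f \<noteq> g \<Longrightarrow> df f \<inter> df g = {}"
    and meet: "\<And>v e. v \<in> V \<Longrightarrow> e \<in> E \<Longrightarrow> dv v \<inter> de e \<subseteq> disc_boundary Y (de e)"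
      "\<And>v f. v \<in> V \<Longrightarrow> f \<in> F \<Longrightarrow> dv v \<inter> df f \<subseteq> disc_boundary Y (df f)"
      "\<And>e f. e \<in> E \<Longrightarrow> f \<in> F \<Longrightarrow> de e \<inter> df f \<subseteq> disc_boundary Y (df f)"
  shows "cell_decomposition Y (V <+> E <+> F) (case_sum dv (case_sum de df))"
    and "cell_decomposition Y (F <+> E <+> V) (case_sum df (case_sum de dv))"
proof -
  note flip = disc_Int_subset_boundary[OF Y(2)]
  have meet': "dv v \<inter> de e \<subseteq> disc_boundary Y (dv v)" if "v \<in> V" "e \<in> E" for v e
    using flip[OF disc(1) disc(2) meet(1)] that by blast
  have meet'': "dv v \<inter> df f \<subseteq> disc_boundary Y (dv v)" if "v \<in> V" "f \<in> F" for v f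
    using flip[OF disc(1) disc(3) meet(2)] that by blast
  have meet''': "de e \<inter> df f \<subseteq> disc_boundary Y (de e)" if "e \<in> E" "f \<in> F" for e f
    using flip[OF disc(2) disc(3) meet(3)] that by blast
  show "cell_decomposition Y (V <+> E <+> F) (case_sum dv (case_sum de df))"
  proof
    fix i j assume "i \<in> V <+> E <+> F" "j \<in> V <+> E <+> F" "i \<noteq> j"
    then show "case_sum dv (case_sum de df) i \<inter> case_sum dv (case_sum de df) j
        \<subseteq> disc_boundary Y (case_sum dv (case_sum de df) i)"
      using disj meet meet' meet'' meet''' by (elim PlusE) (simp_all add: Int_commute)
  qed (use Y fin disc cover in \<open>auto simp: Plus_def\<close>)
  show "cell_decomposition Y (F <+> E <+> V) (case_sum df (case_sum de dv))"
  proof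
    fix i j assume "i \<in> F <+> E <+> V" "j \<in> F <+> E <+> V" "i \<noteq> j"
    then show "case_sum df (case_sum de dv) i \<inter> case_sum df (case_sum de dv) j
        \<subseteq> disc_boundary Y (case_sum df (case_sum de dv) i)"
      using disj meet meet' meet'' meet''' by (elim PlusE) (simp_all add: Int_commute)
  qed (use Y fin disc cover in \<open>auto simp: Plus_def\<close>)
qed


lemma subtopology_segment:
  assumes "is_segment (subtopology Y Z) s" shows "is_segment Y s"
proof -
  have s: "s \<subseteq> topspace Y" "s \<subseteq> Z" using assms by (auto simp: is_segment_def)
  then have "subtopology (subtopology Y Z) s = subtopology Y s"
    by (simp add: subtopology_subtopology inf_absorb2)
  then show ?thesis
    using assms s unfolding is_segment_def by simp
qed

lemma forest_empty: "is_forest G {}"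
  by (auto simp: is_forest_def is_cycle_def)

text \<open>The empty surface is connected, but it has no connected component. The empty set of edges
  is feasible since the number of boundary components is zero as well.\<close>

lemma delta_matroid_matroids_no_vertices:
  assumes G: "ribbon_graph G" "verts G = {}" and H: "edges H = edges G"
  shows "D_min (delta_matroid_of G) = cycle_matroid G"
    and "D_max (delta_matroid_of G) = dual_matroid (cycle_matroid H)"
proof -
  have E: "edges G = {}"
    using ribbon_graph_attachment(2)[OF G(1)] G(2) by blast
  then have "topspace (surf G) = {}"
    using ribbon_graph_discs(6)[OF G(1)] G(2) by simp
  then have triv: "surf G = trivial_topology"
    by (simp add: null_topspace_iff_trivial)
  have "num_boundary G {} = 0" "num_components G = 0"
    by (auto simp: num_boundary_def num_components_def boundary_components_def spanning_surface_def triv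
        connected_components_of_empty_space)
  then have feasible: "delta_matroid_of G = ({}, {{}})"
    by (auto simp: delta_matroid_of_def E)
  have cycle: "cycle_matroid K = ({}, {{}})" if "edges K = {}" for K :: "('x, 'b) ribbon"
  proof -
    have "is_forest K A \<longleftrightarrow> A = {}" for A
      using forest_empty[of K] that by (auto simp: is_forest_def)
    then show ?thesis by (auto simp: cycle_matroid_def that)
  qed
  show "D_min (delta_matroid_of G) = cycle_matroid G"
    unfolding feasible cycle[OF E] by (auto simp: D_min_def)
  show "D_max (delta_matroid_of G) = dual_matroid (cycle_matroid H)"
    unfolding feasible cycle[OF H[unfolded E]] by (auto simp: D_max_def dual_matroid_def)
qed

lemma largest_iff_smallest_complement:
  fixes P Q :: "'a set \<Rightarrow> bool"
  assumes E: "finite E" "X \<subseteq> E" and PQ: "\<And>A. A \<subseteq> E \<Longrightarrow> P A \<longleftrightarrow> Q (E - A)"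
  shows "P X \<and> (\<forall>Z. Z \<subseteq> E \<and> P Z \<longrightarrow> card Z \<le> card X) \<longleftrightarrow>
    Q (E - X) \<and> (\<forall>B. B \<subseteq> E \<and> Q B \<longrightarrow> card (E - X) \<le> card B)"
proof -
  have card: "card (E - A) = card E - card A" "card A \<le> card E" if "A \<subseteq> E" for A
    using that E(1) card_mono[OF E(1) that] by (auto simp: card_Diff_subset finite_subset)
  have "(\<forall>Z. Z \<subseteq> E \<and> P Z \<longrightarrow> card Z \<le> card X) \<longleftrightarrow> (\<forall>B. B \<subseteq> E \<and> Q B \<longrightarrow> card (E - X) \<le> card B)"
  proof (intro iffI allI impI)
    fix B assume *: "\<forall>Z. Z \<subseteq> E \<and> P Z \<longrightarrow> card Z \<le> card X" and B: "B \<subseteq> E \<and> Q B"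
    then have "E - (E - B) = B" by blast
    then have "card (E - B) \<le> card X" using * B PQ[of "E - B"] by simp
    then show "card (E - X) \<le> card B" using card[of B] card[of X] B E(2) by simp
  next
    fix Z assume *: "\<forall>B. B \<subseteq> E \<and> Q B \<longrightarrow> card (E - X) \<le> card B" and Z: "Z \<subseteq> E \<and> P Z"
    then have "card (E - X) \<le> card (E - Z)" using PQ[of Z] by simp
    then show "card Z \<le> card X" using card[of Z] card[of X] Z E(2) by linarith
  qed
  then show ?thesis using PQ[OF E(2)] by simp
qed

text \<open>Feasibility of \<open>A\<close> becomes \<open>circular\<close> for the vertices and \<open>A\<close>, and, by the symmetry of
  \<open>interface\<close>, also \<open>circular\<close> for the caps and \<open>E - A\<close>. Both matroids are then found by
  \<open>smallest_circular_iff_tree\<close>, once for \<open>G\<close> and once for the dual.\<close>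

lemma delta_matroid_matroids:
  fixes G :: "('p, 'e) ribbon" and H :: "('q, 'e) ribbon"
  assumes G: "ribbon_graph G" and con: "connected_ribbon G" and dual: "geometric_dual G H" and ne: "verts G \<noteq> {}"
  shows "D_min (delta_matroid_of G) = cycle_matroid G"
    and "D_max (delta_matroid_of G) = dual_matroid (cycle_matroid H)"
proof -
  have H: "ribbon_graph H" using dual by (simp add: geometric_dual_def)
  obtain Y h where Y: "surface Y" "surface_boundary Y = {}" and h: "embedding_map (surf G) Y h"
    and top: "topspace Y = h ` topspace (surf G) \<union> \<Union>(verts H)"
    and caps: "\<forall>d \<in> verts H. is_disc Y d \<and> d \<inter> h ` topspace (surf G) = disc_boundary Y d"
    and edges: "edges H = edges G" and eH: "\<forall>e \<in> edges G. edge_disc H e = h ` edge_disc G e"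
    and surfH: "surf H = subtopology Y (\<Union>(verts H) \<union> \<Union>(edge_disc H ` edges H))"
    using dual unfolding geometric_dual_def by (elim conjE exE) blast
  note dG = ribbon_graph_discs[OF G] and dH = ribbon_graph_discs[OF H]
  let ?V = "verts G" and ?E = "edges G" and ?F = "verts H" and ?de = "edge_disc H"
  let ?X = "topspace (surf G)" and ?df = "\<lambda>d. d"
  have hom: "homeomorphic_map (surf G) (subtopology Y (h ` ?X)) h"
    using h by (simp add: embedding_map_def)
  have inj: "inj_on h ?X" by (rule homeomorphic_imp_injective_map[OF hom])
  have VX: "v \<subseteq> ?X" if "v \<in> ?V" for v using dG(6) that by blast
  have EX: "edge_disc G e \<subseteq> ?X" if "e \<in> ?E" for e using dG(6) that by blast
  have hX: "h ` ?X = \<Union>((`) h ` ?V) \<union> \<Union>(?de ` ?E)"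
  proof -
    have "\<Union>(?de ` ?E) = h ` \<Union>(edge_disc G ` ?E)" using eH by (simp add: image_Union image_image)
    then show ?thesis by (simp only: dG(6) image_Un image_Union)
  qed
  have disc_e: "is_disc Y (?de e)" "disc_boundary Y (?de e) = h ` disc_boundary (surf G) (edge_disc G e)" if "e \<in> ?E" for e
    using embedded_disc[OF h dG(5)[OF that]] eH that by auto
  have disc_v: "is_disc Y (h ` v)" if "v \<in> ?V" for v
    using embedded_disc(1)[OF h dG(4)[OF that]] .
  have h_Int: "h ` a \<inter> h ` b = h ` (a \<inter> b)" if "a \<subseteq> ?X" "b \<subseteq> ?X" for a b
    using inj_on_image_Int[OF inj that] by simp
  have disj_v: "h ` v \<inter> h ` w = {}" if "v \<in> ?V" "w \<in> ?V" "v \<noteq> w" for v w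
    using h_Int[OF VX VX, of v w] dG(7)[of v w] that by simp
  have disj_e: "?de e \<inter> ?de e' = {}" if "e \<in> ?E" "e' \<in> ?E" "e \<noteq> e'" for e e'
    using dH(8)[of e e'] that edges by simp
  have ve: "h ` v \<inter> ?de e = h ` (v \<inter> edge_disc G e)" if "v \<in> ?V" "e \<in> ?E" for v e
    using h_Int[OF VX EX, of v e] that eH by simp
  have meet_ve: "h ` v \<inter> ?de e \<subseteq> disc_boundary Y (?de e)" if "v \<in> ?V" "e \<in> ?E" for v e
    unfolding ve[OF that] disc_e(2)[OF that(2)]
    by (rule image_mono[OF ribbon_graph_attachment(1)[OF G that(2,1)]])
  have meet_vf: "h ` v \<inter> f \<subseteq> disc_boundary Y f" if "v \<in> ?V" "f \<in> ?F" for v f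
  proof -
    have "h ` v \<subseteq> h ` ?X" using VX[OF that(1)] by (rule image_mono)
    then show ?thesis using caps that(2) by blast
  qed
  have meet_ef: "?de e \<inter> f \<subseteq> disc_boundary Y f" if "e \<in> ?E" "f \<in> ?F" for e f
  proof -
    have "?de e \<subseteq> h ` ?X" using EX[OF that(1)] eH that(1) by (simp add: image_mono)
    then show ?thesis using caps that(2) by blast
  qed
  have Hausdorff: "Hausdorff_space Y" using Y(1) by (simp add: surface_def)
  have cover: "topspace Y = \<Union>((`) h ` ?V) \<union> \<Union>(?de ` ?E) \<union> \<Union>(?df ` ?F)"
    using top hX by simp
  have disc_f: "is_disc Y f" if "f \<in> ?F" for f using caps that by blast
  have dec: "cell_decomposition Y (?V <+> ?E <+> ?F) (case_sum ((`) h) (case_sum ?de ?df))"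
    "cell_decomposition Y (?F <+> ?E <+> ?V) (case_sum ?df (case_sum ?de ((`) h)))"
    using cell_decompositionI[OF Hausdorff Y(2) dG(2,3) dH(2), of "(`) h" ?de ?df]
      disc_v disc_e(1) disc_f cover disj_v disj_e dH(7) meet_ve meet_vf meet_ef by blast+
  have connX: "connectedin Y (h ` ?X)"
  proof -
    have "connectedin (surf G) ?X" using con by (simp add: connected_ribbon_def connectedin_topspace)
    moreover have "continuous_map (surf G) Y h"
      using homeomorphic_imp_continuous_map[OF hom] by (simp add: continuous_map_in_subtopology)
    ultimately show ?thesis by (metis connectedin_continuous_map_image)
  qed
  obtain v0 where v0: "v0 \<in> ?V" using ne by blast
  have X_ne: "?X \<noteq> {}" using VX[OF v0] disc_nonempty[OF dG(4)[OF v0]] by blast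
  \<comment> \<open>every cap touches the connected set \<open>h ` ?X\<close> along its boundary\<close>
  have connY: "connected_space Y"
  proof -
    have "connectedin Y (\<Union>((\<lambda>f. h ` ?X \<union> f) ` insert (h ` ?X) ?F))"
    proof (rule connectedin_Union)
      show "connectedin Y S" if S: "S \<in> (\<lambda>f. h ` ?X \<union> f) ` insert (h ` ?X) ?F" for S
      proof -
        consider "S = h ` ?X" | f where "f \<in> ?F" "S = h ` ?X \<union> f" using S by blast
        then show ?thesis
        proof cases
          case 2
          have "h ` ?X \<inter> f \<noteq> {}"
            using caps 2(1) disc_boundary_nonempty[OF disc_f[OF 2(1)]] by (simp add: Int_commute)
          then show ?thesis unfolding 2(2)
            by (intro connectedin_Un connX connectedin_disc disc_f 2(1))
        qed (simp add: connX)
      qed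
      show "\<Inter>((\<lambda>f. h ` ?X \<union> f) ` insert (h ` ?X) ?F) \<noteq> {}" using X_ne by blast
    qed
    moreover have "\<Union>((\<lambda>f. h ` ?X \<union> f) ` insert (h ` ?X) ?F) = topspace Y" using top by auto
    ultimately show ?thesis by (simp add: connectedin_topspace)
  qed
  have ends_G: "\<exists>s t. \<exists>u \<in> ?V. \<exists>w \<in> ?V. is_segment Y s \<and> is_segment Y t \<and>
       ?de e \<inter> \<Union>((`) h ` ?V) = s \<union> t \<and> s \<subseteq> h ` u \<and> t \<subseteq> h ` w" if e: "e \<in> ?E" for e
  proof -
    obtain s t u w where st: "u \<in> ?V" "w \<in> ?V" "is_segment (surf G) s" "is_segment (surf G) t"
      "edge_disc G e \<inter> \<Union>?V = s \<union> t" "s \<subseteq> u" "t \<subseteq> w"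
      using ribbon_graph_attachment(2)[OF G e] by blast
    have "?de e \<inter> \<Union>((`) h ` ?V) = h ` edge_disc G e \<inter> h ` \<Union>?V" using eH e by (simp add: image_Union)
    also have "\<dots> = h ` (edge_disc G e \<inter> \<Union>?V)" using dG(6) by (intro h_Int EX e) blast
    also have "\<dots> = h ` s \<union> h ` t" by (simp only: st(5) image_Un)
    finally show ?thesis
      using st(1,2) image_mono[OF st(6)] image_mono[OF st(7)] embedded_segment[OF h st(3)] embedded_segment[OF h st(4)]
      by (intro exI[of _ "h ` s"] exI[of _ "h ` t"] bexI[of _ u] bexI[of _ w] conjI)
  qed
  interpret G: ribbon_decomposition Y ?V "(`) h" ?E ?de ?F ?df
    by (rule ribbon_decomposition.intro[OF dec(1) connY ne disj_v disj_e ends_G])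
  have ends_H: "\<exists>s t. \<exists>u \<in> ?F. \<exists>w \<in> ?F. is_segment Y s \<and> is_segment Y t \<and>
       ?de e \<inter> \<Union>(?df ` ?F) = s \<union> t \<and> s \<subseteq> u \<and> t \<subseteq> w" if e: "e \<in> ?E" for e
  proof -
    obtain s t u w where st: "u \<in> ?F" "w \<in> ?F" "is_segment (surf H) s" "is_segment (surf H) t"
      "?de e \<inter> \<Union>?F = s \<union> t" "s \<subseteq> u" "t \<subseteq> w"
      using ribbon_graph_attachment(2)[OF H, of e] e edges by auto
    moreover have "is_segment Y s" "is_segment Y t"
      using st(3,4) subtopology_segment unfolding surfH by blast+
    ultimately show ?thesis
      by (intro exI[of _ s] exI[of _ t] bexI[of _ u] bexI[of _ w] conjI) simp_all
  qed
  have spans_E: "G.spans ?E"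
    using connX hX by (intro G.connected_spans) (simp_all add: G.ribbons_def)
  obtain T where T: "T \<subseteq> ?E" "G.tree ?V T"
    using G.spanning_tree_exists[OF spans_E] by blast
  have circ_T: "G.circular (G.subcells ?V T)" by (rule G.tree_circular[OF T(2)])
  \<comment> \<open>without caps there would be no edges, and the single vertex would have no boundary in \<open>Y\<close>\<close>
  have F_ne: "?F \<noteq> {}"
  proof
    assume F: "?F = {}"
    then have "?E = {}" using ends_H by blast
    then have "G.interface (G.subcells ?V T) = {}" unfolding G.interface_ribbons using F by simp
    then show False using circ_T by (simp add: G.circular_def)
  qed
  interpret H: ribbon_decomposition Y ?F ?df ?E ?de ?V "(`) h"
    by (rule ribbon_decomposition.intro[OF dec(2) connY F_ne dH(7) disj_e ends_H])
  have interface_dual: "G.interface (G.subcells ?V A) = H.interface (H.subcells ?F (?E - A))" if "A \<subseteq> ?E" for A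
  proof -
    have "?E - (?E - A) = A" using that by blast
    then show ?thesis
      unfolding G.interface_ribbons H.interface_ribbons G.ribbons_def H.ribbons_def by (simp add: Un_commute Int_commute)
  qed
  then have circular_dual: "G.circular (G.subcells ?V A) \<longleftrightarrow> H.circular (H.subcells ?F (?E - A))" if "A \<subseteq> ?E" for A
    using that by (simp add: G.circular_def H.circular_def)
  \<comment> \<open>the dual is connected because the complement of a spanning tree of \<open>G\<close> connects it\<close>
  have spans_E_dual: "H.spans ?E"
    using H.circular_spans[of "?E - T"] circular_dual[OF T(1)] circ_T H.spans_mono by blast
  have components: "num_components G = 1"
  proof -
    have "surf G \<noteq> trivial_topology" using X_ne by auto
    then have "connected_components_of (surf G) = {?X}"
      using con by (simp add: connected_components_of_eq_singleton connected_ribbon_def)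
    then show ?thesis by (simp add: num_components_def)
  qed
  have feasible: "num_boundary G A = 1 \<longleftrightarrow> G.circular (G.subcells ?V A)" if A: "A \<subseteq> ?E" for A
  proof -
    define K where "K = \<Union>?V \<union> \<Union>(edge_disc G ` A)"
    have KX: "K \<subseteq> ?X" using dG(6) A by (auto simp: K_def)
    have "h ` K = G.ribbons ?V A"
      unfolding K_def G.ribbons_def image_Un image_Union image_image using eH A by (auto simp: subset_iff)
    then have hK: "h ` K = \<Union>(case_sum ((`) h) (case_sum ?de ?df) ` G.subcells ?V A)"
      by (simp only: G.cells_ribbons)
    have "num_boundary G A = 1 \<longleftrightarrow> card (boundary_components (subtopology (surf G) K)) = 1"
      by (simp add: num_boundary_def spanning_surface_def K_def)
    also have "\<dots> \<longleftrightarrow> card (boundary_components (subtopology Y (h ` K))) = 1"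
      by (rule card_boundary_components_homeomorphic[OF embedding_map_subtopology[OF h KX]])
    also have "\<dots> \<longleftrightarrow> G.circular (G.subcells ?V A)"
    proof -
      have "G.subcells ?V A \<subseteq> ?V <+> ?E <+> ?F" using A by auto
      then show ?thesis
        unfolding card_boundary_components_subtopology hK G.circular_def by (simp only: G.surface_boundary_cells)
    qed
    finally show ?thesis .
  qed
  have feasible_sets: "snd (delta_matroid_of G) = {A. A \<subseteq> ?E \<and> G.circular (G.subcells ?V A)}"
    unfolding delta_matroid_of_def components using feasible by auto
  have inc_G: "G.inc e = ends G e" if "e \<in> ?E" for e
    unfolding G.inc_def ends_def using ve[OF _ that] by auto
  have "G.cycle vs es \<longleftrightarrow> is_cycle G vs es" for vs es
    unfolding G.cycle_def is_cycle_def using inc_G nth_mem[of _ es] by (auto simp: subset_iff)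
  then have "G.forest A \<longleftrightarrow> is_forest G A" for A
    by (simp add: G.forest_def is_forest_def)
  then have bases_G: "snd (cycle_matroid G) = {A. G.tree ?V A}"
    using G.maximal_forest_iff_spanning_tree[OF spans_E] by (simp add: cycle_matroid_def)
  have "H.inc e = ends H e" for e
    by (simp add: H.inc_def ends_def)
  then have "H.cycle vs es \<longleftrightarrow> is_cycle H vs es" for vs es
    by (simp add: H.cycle_def is_cycle_def edges)
  then have "H.forest A \<longleftrightarrow> is_forest H A" for A
    by (simp add: H.forest_def is_forest_def edges)
  then have bases_H: "snd (cycle_matroid H) = {A. H.tree ?F A}"
    using H.maximal_forest_iff_spanning_tree[OF spans_E_dual] by (simp add: cycle_matroid_def)
  have "snd (D_min (delta_matroid_of G)) = snd (cycle_matroid G)"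
    unfolding D_min_def snd_conv feasible_sets bases_G
    using G.smallest_circular_iff_tree by auto
  then show "D_min (delta_matroid_of G) = cycle_matroid G"
    by (simp add: D_min_def cycle_matroid_def delta_matroid_of_def)
  have max_iff: "X \<subseteq> ?E \<and> G.circular (G.subcells ?V X) \<and> (\<forall>Z. Z \<subseteq> ?E \<and> G.circular (G.subcells ?V Z) \<longrightarrow> card Z \<le> card X)
      \<longleftrightarrow> X \<subseteq> ?E \<and> H.tree ?F (?E - X)" (is "?L \<longleftrightarrow> ?R") for X
  proof (cases "X \<subseteq> ?E")
    case X: True
    have "?L \<longleftrightarrow> H.circular (H.subcells ?F (?E - X)) \<and>
        (\<forall>B. B \<subseteq> ?E \<and> H.circular (H.subcells ?F B) \<longrightarrow> card (?E - X) \<le> card B)"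
      using X largest_iff_smallest_complement[OF dG(3) X, of "\<lambda>A. G.circular (G.subcells ?V A)"
          "\<lambda>B. H.circular (H.subcells ?F B)"] circular_dual by simp
    also have "\<dots> \<longleftrightarrow> H.tree ?F (?E - X)"
      using H.smallest_circular_iff_tree[of "?E - X"] by blast
    finally show ?thesis using X by blast
  qed blast
  have "snd (D_max (delta_matroid_of G)) = {X. X \<subseteq> ?E \<and> H.tree ?F (?E - X)}"
    unfolding D_max_def snd_conv feasible_sets using max_iff by auto
  also have "\<dots> = (\<lambda>B. ?E - B) ` {A. H.tree ?F A}"
  proof (intro set_eqI iffI)
    fix X assume "X \<in> {X. X \<subseteq> ?E \<and> H.tree ?F (?E - X)}"
    then show "X \<in> (\<lambda>B. ?E - B) ` {A. H.tree ?F A}" by (intro image_eqI[of _ _ "?E - X"]) auto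
  next
    fix X assume "X \<in> (\<lambda>B. ?E - B) ` {A. H.tree ?F A}"
    then obtain B where B: "X = ?E - B" "H.tree ?F B" by blast
    then have "?E - X = B" using H.tree_subset[OF B(2)] by blast
    then show "X \<in> {X. X \<subseteq> ?E \<and> H.tree ?F (?E - X)}" using B by auto
  qed
  finally have "snd (D_max (delta_matroid_of G)) = snd (dual_matroid (cycle_matroid H))"
    by (simp add: dual_matroid_def bases_H) (simp add: cycle_matroid_def edges)
  then show "D_max (delta_matroid_of G) = dual_matroid (cycle_matroid H)"
    by (simp add: D_max_def dual_matroid_def delta_matroid_of_def cycle_matroid_def edges)
qed

theorem theorem6p2:
  fixes G :: "('p, 'e) ribbon" and H :: "('q, 'e) ribbon" and x y z :: "'r::comm_ring_1"
  assumes "ribbon_graph G" and "connected_ribbon G"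
    and "geometric_dual G H"
  shows "las_vergnas_ribbon G H x y z = las_vergnas_delta (delta_matroid_of G) x y z"
proof -
  have "edges H = edges G" using assms(3) by (auto simp: geometric_dual_def)
  then have "D_min (delta_matroid_of G) = cycle_matroid G"
    "D_max (delta_matroid_of G) = dual_matroid (cycle_matroid H)"
    using delta_matroid_matroids[OF assms] delta_matroid_matroids_no_vertices[OF assms(1)] by metis+
  then show ?thesis
    by (simp add: las_vergnas_ribbon_def las_vergnas_delta_def delta_matroid_of_def)
qed

end
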